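(* Let $n\ge 2$, let $\mathcal B$ be the level-$1$ perfect crystal of type $C_n^{(1)}$ described in the context, and let $\mathcal S/\!\sim$ be the set of equivalence classes of level-$1$ slices of type $C_n^{(1)}$, equipped with the Kashiwara operators $\tilde e_i,\tilde f_i$ ($i=0,\dots,n$) induced from the slice operators described in the context. Then the map $\Phi:\mathcal B\to\mathcal S/\!\sim$ described in the context is an isomorphism of $U_q'(C_n^{(1)})$-crystals.
   Context: Let $n\ge2$, $I=\{0,1,\dots,n\}$. The perfect crystal $\mathcal B$: it is the set of $b=(x_1,\dots,x_n\,|\,\bar x_n,\dots,\bar x_1)$ with $x_i,\bar x_i\in\mathbb Z_{\ge0}$ and $\sum_i(x_i+\bar x_i)\in\{0,2\}$. The operators are: $\tilde f_0 b$ adds $2$ to $x_1$ if $x_1\ge\bar x_1$; adds $1$ to $x_1$ and subtracts $1$ from $\bar x_1$ if $x_1=\bar x_1-1$; subtracts $2$ from $\bar x_1$ if $x_1\le \bar x_1-2$. For $1\le i\le n-1$: $\tilde f_i b$ replaces $(x_i,x_{i+1})$ by $(x_i-1,x_{i+1}+1)$ if $x_{i+1}\ge\bar x_{i+1}$, and replaces $(\bar x_{i+1},\bar x_i)$ by $(\bar x_{i+1}-1,\bar x_i+1)$ if $x_{i+1}<\bar x_{i+1}$. $\tilde f_n b$ replaces $(x_n,\bar x_n)$ by $(x_n-1,\bar x_n+1)$. $\tilde e_0 b$ subtracts $2$ from $x_1$ if $x_1\ge\bar x_1+2$; subtracts $1$ from $x_1$ and adds $1$ to $\bar x_1$ if $x_1=\bar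 x_1+1$; adds $2$ to $\bar x_1$ if $x_1\le\bar x_1$. For $1\le i\le n-1$: $\tilde e_i b$ replaces $(x_i,x_{i+1})$ by $(x_i+1,x_{i+1}-1)$ if $x_{i+1}>\bar x_{i+1}$, and $(\bar x_{i+1},\bar x_i)$ by $(\bar x_{i+1}+1,\bar x_i-1)$ if $x_{i+1}\le\bar x_{i+1}$. $\tilde e_n b$ replaces $(x_n,\bar x_n)$ by $(x_n+1,\bar x_n-1)$. In all cases the result is $0$ if it leaves the set $\mathcal B$ (a negative entry). Also $\varphi_i(b)=\max\{m:\tilde f_i^m b\ne0\}$, $\varepsilon_i(b)=\max\{m:\tilde e_i^m b\ne0\}$, $\mathrm{wt}(b)=\sum_i(\varphi_i(b)-\varepsilon_i(b))\Lambda_i$. Blocks and the pattern: a $0$-block has half-unit height; an $i$-block ($1\le i\le n$) has unit height. A level-$\tfrac12$ slice is a finite set of blocks stacked in one column forming an initial segment of the infinite periodic pattern which, read from the bottom, is $0,0,1,2,\dots,n-1,n,n-1,\dots,2,1,0,0,1,2,\dots$ (the empty slice is allowed). In this pattern, for $1\le i\le n-1$, an $i$-position on an ascending run $1,2,\dots,n$ (closer to the $n$-position above it) is called supporting, and one on a descending run $n,\dots,1$ (closer to the $n$-position below it) is called covering; $0$-positions are covering; $n$-positions are both supporting and covering. A "$\delta$" is a consecutive run of the pattern containing one $n$-block and two $i$-blocks for each $i=0,\dots,n-1$; for a level-$\tfrac12$ slice $c$, $c+\delta$ is $c$ with the next such run stacked on top, and $c-\delta$ (when $c$ contains a $\delta$)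 removes the top such run. The "slot" at the top of $c$ is the first unfilled position of the pattern above $c$. Level-$1$ slice: an ordered pair $C=(c_1,c_2)$ of level-$\tfrac12$ slices with $c_1\subseteq c_2\subseteq c_1+\delta$ (as initial segments) and with an even total number of $0$-blocks; $c_j$ is the $j$th layer. $\mathcal S$ denotes the set of level-$1$ slices. Splitting: for $0<i<n$, an $i$-block can be split in $C$ if the top block of one layer is a covering $i$-block and the top of the other layer is an $(i-1)$-block occupying the position immediately below a supporting $i$-position (i.e. its slot is a supporting $i$-slot); splitting moves the top half of that covering $i$-block onto that supporting $i$-slot. An $n$-block can be split if one layer has top block $n$ and the other layer's slot is an $n$-slot. $0$-blocks are never split. Slice operators for $1\le i\le n$, $\tilde f_iC$: (1) if $i\ne n$ and an $(i+1)$-block can be split in $C$, the result is $0$; (2) else if neither layer's top slot is an $i$-slot, result $0$; (3) else if exactly one is, put an $i$-block there; (4) else (both top slots are $i$-slots) if $i=n$ or both slots are of the same kind (supporting/covering): if they are at different heights put the $i$-block in the first layer (the lower slot), otherwise in the second layer; (5) otherwise put the $i$-block in the covering slot. $\tilde f_0C$: if a $1$-block can be split, $0$; if no top slot is a $0$-slot, $0$; if both top slots are $0$-slots, add one $0$-block to each layer; if exactly one is, add two $0$-blocks to that layer. $\tilde e_iC$ ($1\le i\le n$): (1) if $i\ne n$ and an $(i+1)$-block can be split, $0$; (2) if neither top block is an $i$-block, $0$; (3) if exactly one top block is an $i$-block, remove it; (4) if both are and ($i=n$ or same kind): at different heights remove the one in the second layer (the higher), otherwise remove the one in the first layer; (5)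 otherwise remove the supporting $i$-block. $\tilde e_0C$: if a $1$-block can be split, $0$; if neither top block is a $0$-block, $0$; if both are, remove one $0$-block from each layer; if exactly one, remove two $0$-blocks from that layer. If the result is not a level-$1$ slice, it is taken to be $0$. Equivalence: for $C=(c_1,c_2)$ set $C+\delta=(c_2,c_1+\delta)$, and if $c_2\supseteq\delta$, $C-\delta=(c_2-\delta,c_1)$. $C\sim C'$ if one is obtained from the other by adding finitely many $\delta$'s. The operators above commute with $C\mapsto C+\delta$ and hence descend to $\mathcal S/\!\sim$. The map $\Phi$: first define level-$\tfrac12$ slices $P(\cdot)$ for elements of total sum $0$ or $1$: $P(0,\dots,0|0,\dots,0)$ is a single $0$-block; $P(e_1)$ (i.e. $x_1=1$, rest $0$) is two $0$-blocks; for $2\le i\le n$, $P(e_i)$ ($x_i=1$) is the column $0,0,1,\dots,i-1$; $P(\bar e_n)$ ($\bar x_n=1$) is $0,0,1,\dots,n$; for $1\le i\le n-1$, $P(\bar e_i)$ ($\bar x_i=1$) is $0,0,1,\dots,n,n-1,\dots,i$. Any $b\in\mathcal B$ is written as $b=u+u'$ with $u,u'$ of total sum $0$ (if $b=0$) or $1$; $\Phi(b)$ is the $\sim$-class of the level-$1$ slice whose two layers are $P(u)$ and $P(u')$, after possibly adding a $\delta$ to one of them so that the pair is a level-$1$ slice (the class does not depend on the choices).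
   Formalization: The induced operators on a class are computed on a representative whose two layers both contain a δ, since the slice operators do not commute with adding δ on small slices (ẽ_1 kills (∅,∅) but not (∅,δ)); preservation of wt is left implicit in that of φ_i and ε_i. *)

theory Defs
  imports Main
begin

text \<open>A Kashiwara operator is modelled as a partial map; None plays the role of 0.\<close>

definition op_iter :: "('a \<Rightarrow> 'a option) \<Rightarrow> nat \<Rightarrow> 'a \<Rightarrow> 'a option" where
  "op_iter g m x = ((\<lambda>z. Option.bind z g) ^^ m) (Some x)"

definition max_iter :: "('a \<Rightarrow> 'a option) \<Rightarrow> 'a \<Rightarrow> nat" where
  "max_iter g x = (GREATEST m. op_iter g m x \<noteq> None)"

text \<open>An element b = (x_1,...,x_n | xbar_n,...,xbar_1) is a pair of functions (x, xbar),
  with entries indexed by 1..n (and zero outside); entries are taken in int so that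
  the operators may produce negative entries, which then leave the set.\<close>

type_synonym celt = "(nat \<Rightarrow> int) \<times> (nat \<Rightarrow> int)"

definition csum :: "nat \<Rightarrow> celt \<Rightarrow> int" where
  "csum n b = (\<Sum>i\<in>{1..n}. fst b i + snd b i)"

definition wellsupp :: "nat \<Rightarrow> celt \<Rightarrow> bool" where
  "wellsupp n b \<longleftrightarrow> (\<forall>i. (i < 1 \<or> n < i) \<longrightarrow> fst b i = 0 \<and> snd b i = 0)
                    \<and> (\<forall>i. 0 \<le> fst b i \<and> 0 \<le> snd b i)"

definition Bcr :: "nat \<Rightarrow> celt set" where
  "Bcr n = {b. wellsupp n b \<and> csum n b \<in> {0, 2}}"

definition inB :: "nat \<Rightarrow> celt \<Rightarrow> celt option" where
  "inB n b = (if b \<in> Bcr n then Some b else None)"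

definition fB :: "nat \<Rightarrow> nat \<Rightarrow> celt \<Rightarrow> celt option" where
  "fB n i b = (case b of (x, y) \<Rightarrow>
     if i = 0 then
       (if x 1 \<ge> y 1 then inB n (x(1 := x 1 + 2), y)
        else if x 1 = y 1 - 1 then inB n (x(1 := x 1 + 1), y(1 := y 1 - 1))
        else inB n (x, y(1 := y 1 - 2)))
     else if i < n then
       (if x (i+1) \<ge> y (i+1) then inB n (x(i := x i - 1, i+1 := x (i+1) + 1), y)
        else inB n (x, y(i+1 := y (i+1) - 1, i := y i + 1)))
     else if i = n then inB n (x(n := x n - 1), y(n := y n + 1))
     else None)"

definition eB :: "nat \<Rightarrow> nat \<Rightarrow> celt \<Rightarrow> celt option" where
  "eB n i b = (case b of (x, y) \<Rightarrow>
     if i = 0 then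
       (if x 1 \<ge> y 1 + 2 then inB n (x(1 := x 1 - 2), y)
        else if x 1 = y 1 + 1 then inB n (x(1 := x 1 - 1), y(1 := y 1 + 1))
        else inB n (x, y(1 := y 1 + 2)))
     else if i < n then
       (if x (i+1) > y (i+1) then inB n (x(i := x i + 1, i+1 := x (i+1) - 1), y)
        else inB n (x, y(i+1 := y (i+1) + 1, i := y i - 1)))
     else if i = n then inB n (x(n := x n + 1), y(n := y n - 1))
     else None)"

text \<open>The periodic pattern 0,0,1,...,n-1,n,n-1,...,1 has period 2n+1. A level-1/2 slice
  is an initial segment of the pattern and is represented by its length m
  (it occupies positions 0..m-1; its slot is position m).\<close>

definition per :: "nat \<Rightarrow> nat" where "per n = 2*n + 1"

definition col :: "nat \<Rightarrow> nat \<Rightarrow> nat" where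
  "col n k = (let r = k mod per n in
     if r \<le> 1 then 0 else if r \<le> n + 1 then r - 1 else per n - r)"

text \<open>supporting: ascending run 1..n (the n-position included);
  covering: descending run n..1, the n-position, and the 0-positions.\<close>
definition supp :: "nat \<Rightarrow> nat \<Rightarrow> bool" where
  "supp n k \<longleftrightarrow> (let r = k mod per n in 2 \<le> r \<and> r \<le> n + 1)"

definition covr :: "nat \<Rightarrow> nat \<Rightarrow> bool" where
  "covr n k \<longleftrightarrow> (let r = k mod per n in r \<le> 1 \<or> n + 1 \<le> r)"

text \<open>height of the bottom of position k, in half units (0-blocks have height 1/2).\<close>
definition hgt :: "nat \<Rightarrow> nat \<Rightarrow> nat" where
  "hgt n k = (\<Sum>j<k. if col n j = 0 then 1 else 2)"

definition nzeros :: "nat \<Rightarrow> nat \<Rightarrow> nat" where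
  "nzeros n m = card {k. k < m \<and> col n k = 0}"

type_synonym slice = "nat \<times> nat"

definition L1 :: "nat \<Rightarrow> slice set" where
  "L1 n = {(a, b). a \<le> b \<and> b \<le> a + per n \<and> even (nzeros n a + nzeros n b)}"

definition chk :: "nat \<Rightarrow> slice \<Rightarrow> slice option" where
  "chk n C = (if C \<in> L1 n then Some C else None)"

definition topis :: "nat \<Rightarrow> nat \<Rightarrow> nat \<Rightarrow> bool" where
  "topis n i m \<longleftrightarrow> 0 < m \<and> col n (m - 1) = i"

definition split1 :: "nat \<Rightarrow> nat \<Rightarrow> nat \<Rightarrow> nat \<Rightarrow> bool" where
  "split1 n i m m' \<longleftrightarrow>
     (if i < n then topis n i m \<and> covr n (m - 1) \<and> col n m' = i \<and> supp n m'
      else topis n n m \<and> col n m' = n)"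

definition can_split :: "nat \<Rightarrow> nat \<Rightarrow> slice \<Rightarrow> bool" where
  "can_split n i C \<longleftrightarrow> 0 < i \<and> i \<le> n \<and> (split1 n i (fst C) (snd C) \<or> split1 n i (snd C) (fst C))"

definition sf :: "nat \<Rightarrow> nat \<Rightarrow> slice \<Rightarrow> slice option" where
  "sf n i C = (case C of (a, b) \<Rightarrow>
     if i = 0 then
       (if can_split n 1 C then None
        else if col n a = 0 \<and> col n b = 0 then chk n (a + 1, b + 1)
        else if col n a = 0 then chk n (a + 2, b)
        else if col n b = 0 then chk n (a, b + 2)
        else None)
     else if n < i then None
     else if i < n \<and> can_split n (i + 1) C then None
     else if col n a \<noteq> i \<and> col n b \<noteq> i then None
     else if col n a = i \<and> col n b \<noteq> i then chk n (a + 1, b)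
     else if col n a \<noteq> i \<and> col n b = i then chk n (a, b + 1)
     else if i = n \<or> supp n a = supp n b then
       (if hgt n a \<noteq> hgt n b then chk n (a + 1, b) else chk n (a, b + 1))
     else if covr n a then chk n (a + 1, b) else chk n (a, b + 1))"

definition se :: "nat \<Rightarrow> nat \<Rightarrow> slice \<Rightarrow> slice option" where
  "se n i C = (case C of (a, b) \<Rightarrow>
     if i = 0 then
       (if can_split n 1 C then None
        else if topis n 0 a \<and> topis n 0 b then chk n (a - 1, b - 1)
        else if topis n 0 a then (if 2 \<le> a then chk n (a - 2, b) else None)
        else if topis n 0 b then (if 2 \<le> b then chk n (a, b - 2) else None)
        else None)
     else if n < i then None
     else if i < n \<and> can_split n (i + 1) C then None
     else if \<not> topis n i a \<and> \<not> topis n i b then None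
     else if topis n i a \<and> \<not> topis n i b then chk n (a - 1, b)
     else if \<not> topis n i a \<and> topis n i b then chk n (a, b - 1)
     else if i = n \<or> supp n (a - 1) = supp n (b - 1) then
       (if hgt n (a - 1) \<noteq> hgt n (b - 1) then chk n (a, b - 1) else chk n (a - 1, b))
     else if supp n (a - 1) then chk n (a - 1, b) else chk n (a, b - 1))"

definition plus_delta :: "nat \<Rightarrow> slice \<Rightarrow> slice" where
  "plus_delta n C = (snd C, fst C + per n)"

definition sim_rel :: "nat \<Rightarrow> (slice \<times> slice) set" where
  "sim_rel n = {(C, D). C \<in> L1 n \<and> D \<in> L1 n \<and>
                  (\<exists>k. D = (plus_delta n ^^ k) C \<or> C = (plus_delta n ^^ k) D)}"

definition SQ :: "nat \<Rightarrow> slice set set" where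
  "SQ n = L1 n // sim_rel n"

definition cls :: "nat \<Rightarrow> slice \<Rightarrow> slice set" where
  "cls n C = sim_rel n `` {C}"

definition deep_rep :: "nat \<Rightarrow> slice set \<Rightarrow> slice" where
  "deep_rep n X = (SOME C. C \<in> X \<and> per n \<le> fst C)"

definition fQ :: "nat \<Rightarrow> nat \<Rightarrow> slice set \<Rightarrow> slice set option" where
  "fQ n i X = map_option (cls n) (sf n i (deep_rep n X))"

definition eQ :: "nat \<Rightarrow> nat \<Rightarrow> slice set \<Rightarrow> slice set option" where
  "eQ n i X = map_option (cls n) (se n i (deep_rep n X))"

definition unitB :: "nat \<Rightarrow> celt set" where
  "unitB n = {u. wellsupp n u \<and> csum n u \<in> {0, 1}}"

definition Pslice :: "nat \<Rightarrow> celt \<Rightarrow> nat" where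
  "Pslice n u =
    (if \<exists>i\<in>{1..n}. fst u i = 1 then (THE i. i \<in> {1..n} \<and> fst u i = 1) + 1
     else if \<exists>i\<in>{1..n}. snd u i = 1 then
       (let i = (THE i. i \<in> {1..n} \<and> snd u i = 1) in
        if i = n then n + 2 else 2*n + 2 - i)
     else 1)"

definition celt_add :: "celt \<Rightarrow> celt \<Rightarrow> celt" where
  "celt_add u v = (\<lambda>i. fst u i + fst v i, \<lambda>i. snd u i + snd v i)"

definition cands :: "nat \<Rightarrow> nat \<Rightarrow> nat \<Rightarrow> slice set" where
  "cands n p q = {(p, q), (q, p), (p + per n, q), (q + per n, p), (p, q + per n), (q, p + per n)}"

definition Phi :: "nat \<Rightarrow> celt \<Rightarrow> slice set" where
  "Phi n b = cls n (SOME C. C \<in> L1 n \<and>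
      (\<exists>u v. u \<in> unitB n \<and> v \<in> unitB n \<and> celt_add u v = b \<and>
             C \<in> cands n (Pslice n u) (Pslice n v)))"

end

theory Submission
  imports Defs
begin

text \<open>Reading the length of a column modulo the period, with representatives \<open>1, \<dots>, 2n+1\<close>, turns
  a level-\<open>1/2\<close> slice into a letter: the residue \<open>1\<close> is the zero vector and the others are the unit
  vectors \<open>e\<^sub>1, \<dots>, e\<^sub>n\<close>, followed by the barred ones in the order \<open>n, \<dots>, 1\<close>. A level-\<open>1\<close> slice is
  determined up to \<open>\<delta>\<close> by the unordered pair of its residues, and the parity condition on \<open>0\<close>-blocks
  says that either both residues or none of them equal \<open>1\<close>. So slices modulo \<open>\<delta>\<close> correspond to
  elements of the crystal. Both families of operators act on residues by moving one letter a step along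
  the cyclic order (two letters, or two steps, for \<open>i = 0\<close>), and the split condition for \<open>i+1\<close>-blocks singles out
  the pair of \<open>e\<close> and barred \<open>e\<close> with index \<open>i+1\<close>, on which the \<open>i\<close>-operators vanish.\<close>

subsection \<open>Residues of columns\<close>

text \<open>Remainder 0 is replaced by \<open>per n\<close> so that residues are exactly the lengths
  of the columns \<open>Pslice n u\<close> with \<open>u\<close> in \<open>unitB n\<close>. A
  residue determines the slot at position \<open>m\<close> and, for \<open>m > 0\<close>, the top
  block at \<open>m - 1\<close>.\<close>

definition res :: "nat \<Rightarrow> nat \<Rightarrow> nat" where
  "res n m = (if m mod per n = 0 then per n else m mod per n)"

lemma res_ge: "1 \<le> res n m" and res_le: "res n m \<le> per n"
  by (auto simp: res_def per_def Suc_le_eq intro: less_imp_le)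

lemma res_add_per [simp]: "res n (m + per n) = res n m"
  by (simp add: res_def)

lemma res_id: "1 \<le> r \<Longrightarrow> r \<le> per n \<Longrightarrow> res n r = r"
  by (cases "r = per n") (auto simp: res_def)

lemma res_Suc: "res n (Suc m) = (if res n m = per n then 1 else Suc (res n m))" if "1 \<le> n"
proof -
  have "m mod per n < per n" "per n \<noteq> 1" using that by (auto simp: per_def)
  then show ?thesis by (auto simp: res_def mod_Suc)
qed

lemma res_pred: "res n (m - 1) = (if res n m = 1 then per n else res n m - 1)" if "0 < m" "1 \<le> n"
  using res_Suc[of n "m - 1"] that res_ge[of n "m - 1"] res_le[of n "m-1"] by (auto simp: per_def split: if_splits)

text \<open>Remainder 0 borrows one period from the quotient; positivity is what makes this
  possible, as length 0 has residue \<open>per n\<close>.\<close>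

lemma res_decomp: "\<exists>k. m = per n * k + res n m" if "0 < m"
proof -
  have *: "m = per n * (m div per n) + m mod per n" by simp
  show ?thesis
  proof (cases "m mod per n = 0")
    case True
    with * that obtain j where "m div per n = Suc j" by (cases "m div per n") auto
    with * True show ?thesis by (intro exI[of _ j]) (simp add: res_def)
  next
    case False with * show ?thesis by (intro exI[of _ "m div per n"]) (simp add: res_def)
  qed
qed

lemma col_res: "col n m = (if res n m = 1 \<or> res n m = per n then 0
    else if res n m \<le> n + 1 then res n m - 1 else per n - res n m)"
  using mod_less_divisor[of "per n" m] unfolding per_def
  by (auto simp: col_def res_def Let_def per_def)

lemma supp_res: "supp n m \<longleftrightarrow> 2 \<le> res n m \<and> res n m \<le> n + 1" if "1 \<le> n"
  using that by (auto simp: supp_def res_def Let_def per_def)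

lemma covr_res: "covr n m \<longleftrightarrow> res n m = 1 \<or> n + 1 \<le> res n m" if "1 \<le> n"
  using that by (auto simp: covr_def res_def Let_def per_def)

text \<open>The top block lies at position \<open>m - 1\<close>, so this is \<open>col_res\<close>
  one step back in the cyclic order. Residues 1 and 2 are the columns ending in the first and in the
  second 0-block of a pair.\<close>

lemma topis_res: "topis n i m \<longleftrightarrow>
    (if res n m \<le> 2 then i = 0 else if res n m \<le> n + 2 then i + 2 = res n m else i + res n m = 2 * n + 2)"
  if "0 < m" "1 \<le> n"
proof -
  have "res n (m - 1) = (if res n m = 1 then per n else res n m - 1)" using that by (rule res_pred)
  then show ?thesis
    using that res_le[of n m] res_ge[of n m] unfolding topis_def col_res per_def
    by (auto split: if_splits)
qed

lemma hgt_strict_mono: "strict_mono (hgt n)"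
  by (simp add: strict_mono_Suc_iff hgt_def)

text \<open>Blocks have positive height, so the height comparison in the tie-breaking rule becomes a
  comparison of lengths.\<close>

lemma hgt_eq_iff: "hgt n a = hgt n b \<longleftrightarrow> a = b"
  using hgt_strict_mono strict_mono_eq by blast

lemma nzeros_Suc: "nzeros n (Suc m) = nzeros n m + of_bool (col n m = 0)"
proof -
  have "{k. k < Suc m \<and> col n k = 0} = {k. k < m \<and> col n k = 0} \<union> (if col n m = 0 then {m} else {})"
    by (auto simp: less_Suc_eq)
  then show ?thesis by (auto simp: nzeros_def)
qed

text \<open>The 0-blocks come in adjacent pairs, at remainders 0 and 1, so the count is odd exactly
  for columns that stop inside a pair.\<close>

lemma odd_nzeros: "odd (nzeros n m) \<longleftrightarrow> res n m = 1" if "1 \<le> n"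
proof (induction m)
  case 0 then show ?case using that by (simp add: nzeros_def res_def per_def)
next
  case (Suc m)
  then show ?case using res_ge[of n m] res_le[of n m] that
    by (auto simp: nzeros_Suc res_Suc col_res per_def)
qed

lemma L1_iff: "(a, b) \<in> L1 n \<longleftrightarrow> a \<le> b \<and> b \<le> a + per n \<and> (res n a = 1 \<longleftrightarrow> res n b = 1)" if "1 \<le> n"
  using odd_nzeros[OF that, of a] odd_nzeros[OF that, of b] by (auto simp: L1_def)

subsection \<open>Letters\<close>

text \<open>Residue \<open>j + 1\<close> carries the unbarred index \<open>j\<close>, residue
  \<open>2 * n + 2 - j\<close> the barred one. The guard \<open>2 \<le> r\<close> stops residue 1
  from marking index 0, so that it yields the zero vector.\<close>

definition letter :: "nat \<Rightarrow> nat \<Rightarrow> celt" where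
  "letter n r = (\<lambda>j. of_bool (2 \<le> r \<and> r \<le> n + 1 \<and> r = j + 1), \<lambda>j. of_bool (n + 2 \<le> r \<and> r + j = 2 * n + 2))"

definition word :: "nat \<Rightarrow> nat \<Rightarrow> nat \<Rightarrow> celt" where
  "word n r s = celt_add (letter n r) (letter n s)"

lemma celt_add_commute: "celt_add u v = celt_add v u"
  by (simp add: celt_add_def add.commute)

lemma word_commute: "word n r s = word n s r"
  by (simp add: word_def celt_add_commute)

lemma csum_add: "csum n (celt_add u v) = csum n u + csum n v"
  by (simp add: csum_def celt_add_def sum.distrib algebra_simps)

lemma wellsupp_add: "wellsupp n u \<Longrightarrow> wellsupp n v \<Longrightarrow> wellsupp n (celt_add u v)"
  by (auto simp: wellsupp_def celt_add_def)

lemma wellsupp_letter: "r \<le> per n \<Longrightarrow> wellsupp n (letter n r)"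
  by (auto simp: wellsupp_def letter_def per_def)

lemma csum_letter: "csum n (letter n r) = of_bool (2 \<le> r)" if "r \<le> per n"
proof -
  have "csum n (letter n r) = (\<Sum>j=1..n. if j = (if r \<le> n + 1 then r - 1 else 2 * n + 2 - r) \<and> 2 \<le> r then 1 else 0)"
    unfolding csum_def by (rule sum.cong) (use that in \<open>auto simp: letter_def per_def\<close>)
  also have "\<dots> = of_bool (2 \<le> r)"
    using that by (cases "2 \<le> r") (auto simp: per_def)
  finally show ?thesis .
qed

lemma word_in_Bcr: "word n r s \<in> Bcr n" if "r \<le> per n" "s \<le> per n" "1 \<le> r" "1 \<le> s" "r = 1 \<longleftrightarrow> s = 1"
  using that by (auto simp: Bcr_def word_def csum_add csum_letter wellsupp_add wellsupp_letter)

lemma csum_0_imp_letter: "b = letter n 1" if "wellsupp n b" "csum n b = 0"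
proof -
  have "\<forall>j\<in>{1..n}. fst b j + snd b j = 0"
    using that unfolding csum_def by (subst (asm) sum_nonneg_eq_0_iff) (auto simp: wellsupp_def)
  then have "fst b j = 0 \<and> snd b j = 0" for j
    using that(1) unfolding wellsupp_def by (cases "j \<in> {1..n}") (smt (verit) atLeastAtMost_iff not_le)+
  then show ?thesis by (simp add: letter_def prod_eq_iff fun_eq_iff)
qed

lemma letter_unbarred: "1 \<le> j \<Longrightarrow> j \<le> n \<Longrightarrow> letter n (Suc j) = (\<lambda>i. of_bool (i = j), \<lambda>_. 0)"
  by (auto simp: letter_def fun_eq_iff)

lemma letter_barred: "1 \<le> j \<Longrightarrow> j \<le> n \<Longrightarrow> letter n (2 * n + 2 - j) = (\<lambda>_. 0, \<lambda>i. of_bool (i = j))"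
  by (auto simp: letter_def fun_eq_iff)

text \<open>A positive sum forces a positive entry, and subtracting the unit vector there keeps all
  entries nonnegative. Repeating this breaks elements of sum 1 or 2 into letters.\<close>

lemma csum_pos_imp_letter:
  assumes "wellsupp n b" "0 < csum n b"
  obtains r c where "2 \<le> r" "r \<le> per n" "b = celt_add (letter n r) c" "wellsupp n c" "csum n c = csum n b - 1"
proof -
  have "\<exists>j\<in>{1..n}. fst b j + snd b j > 0"
  proof (rule ccontr)
    assume "\<not> ?thesis"
    then have "csum n b \<le> 0" unfolding csum_def by (intro sum_nonpos) force
    with assms show False by simp
  qed
  then obtain j where j: "1 \<le> j" "j \<le> n" "fst b j > 0 \<or> snd b j > 0" by force
  define r where "r = (if fst b j > 0 then j + 1 else 2 * n + 2 - j)"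
  have r: "2 \<le> r" "r \<le> per n" using j by (auto simp: r_def per_def)
  define c :: celt where "c = (\<lambda>i. fst b i - fst (letter n r) i, \<lambda>i. snd b i - snd (letter n r) i)"
  have bc: "b = celt_add (letter n r) c" by (simp add: c_def celt_add_def)
  have "wellsupp n c"
  proof (cases "fst b j > 0")
    case True
    then show ?thesis using assms(1) j letter_unbarred[of j n] by (auto simp: wellsupp_def c_def r_def)
  next
    case False
    then show ?thesis using assms(1) j letter_barred[of j n] by (auto simp: wellsupp_def c_def r_def)
  qed
  moreover have "csum n c = csum n b - 1"
    using csum_add[of n "letter n r" c] csum_letter[of r n] r bc by simp
  ultimately show ?thesis using that r bc by blast
qed

lemma unitB_imp_letter: assumes "u \<in> unitB n" obtains r where "1 \<le> r" "r \<le> per n" "u = letter n r"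
proof (cases "csum n u = 0")
  case True
  then show ?thesis using csum_0_imp_letter[of n u] assms that[of 1] by (auto simp: unitB_def per_def)
next
  case False
  then have u: "wellsupp n u" "csum n u = 1" using assms by (auto simp: unitB_def)
  obtain r c where rc: "2 \<le> r" "r \<le> per n" "u = celt_add (letter n r) c" "wellsupp n c" "csum n c = 0"
    by (rule csum_pos_imp_letter[OF u(1)]) (use u(2) in auto)
  have "c = letter n 1" using csum_0_imp_letter rc by blast
  with rc have "u = letter n r" by (simp add: celt_add_def letter_def)
  then show ?thesis using that[of r] rc(1,2) by simp
qed

lemma letter_in_unitB: "r \<le> per n \<Longrightarrow> letter n r \<in> unitB n"
  by (simp add: unitB_def wellsupp_letter csum_letter)

lemma Bcr_imp_word:
  assumes "b \<in> Bcr n"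
  obtains r s where "1 \<le> r" "r \<le> s" "s \<le> per n" "r = 1 \<longleftrightarrow> s = 1" "b = word n r s"
proof -
  have "\<exists>r s. 1 \<le> r \<and> 1 \<le> s \<and> r \<le> per n \<and> s \<le> per n \<and> (r = 1 \<longleftrightarrow> s = 1) \<and> b = word n r s"
  proof (cases "csum n b = 0")
    case True
    then have "b = letter n 1" using csum_0_imp_letter assms by (auto simp: Bcr_def)
    then have "b = word n 1 1" by (simp add: word_def celt_add_def letter_def)
    then show ?thesis by (intro exI[of _ 1]) (auto simp: per_def)
  next
    case False
    then have b: "wellsupp n b" "csum n b = 2" using assms by (auto simp: Bcr_def)
    obtain r c where rc: "2 \<le> r" "r \<le> per n" "b = celt_add (letter n r) c" "wellsupp n c" "csum n c = 1"
      by (rule csum_pos_imp_letter[OF b(1)]) (use b(2) in auto)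
    have "c \<in> unitB n" using rc by (simp add: unitB_def)
    then obtain s where s: "1 \<le> s" "s \<le> per n" "c = letter n s" by (rule unitB_imp_letter)
    have "s \<noteq> 1" using s rc csum_letter[of s n] by auto
    then show ?thesis using rc s by (intro exI[of _ r] exI[of _ s]) (auto simp: word_def)
  qed
  then obtain r s where "1 \<le> r" "1 \<le> s" "r \<le> per n" "s \<le> per n" "r = 1 \<longleftrightarrow> s = 1" "b = word n r s" by blast
  then show ?thesis using that[of r s] that[of s r] word_commute[of n r s] by (metis nat_le_linear)
qed

lemma word_inject:
  assumes "word n r s = word n r' s'" "1 \<le> r" "1 \<le> s" "1 \<le> r'" "1 \<le> s'"
    "r \<le> per n" "s \<le> per n" "r' \<le> per n" "s' \<le> per n"
  shows "r = r' \<and> s = s' \<or> r = s' \<and> s = r'"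
proof -
  \<comment> \<open>\<open>cnt t\<close> is the multiplicity of the letter \<open>t \<ge> 2\<close>,
    read off at the one coordinate where that letter is nonzero.\<close>
  define cnt where "cnt t b = (if t \<le> n + 1 then fst b (t - 1) else snd b (2 * n + 2 - t))" for t and b :: celt
  have cnt: "cnt t (word n p q) = of_bool (p = t) + of_bool (q = t)"
    if "2 \<le> t" "t \<le> per n" "p \<le> per n" "q \<le> per n" for t p q
    using that by (auto simp: cnt_def word_def celt_add_def letter_def per_def)
  have eq: "(of_bool (r = t) + of_bool (s = t) :: int) = of_bool (r' = t) + of_bool (s' = t)"
    if "2 \<le> t" "t \<le> per n" for t
    using cnt[OF that, of r s] cnt[OF that, of r' s'] assms by simp
  show ?thesis
    \<comment> \<open>Residue 1 is invisible to \<open>cnt\<close>, but each pair has exactly two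
      members, so the other multiplicities determine how often it occurs.\<close>
    using assms(2-) eq[of r] eq[of s] eq[of r'] eq[of s']
    by (cases "r = 1"; cases "s = 1"; cases "r' = 1"; cases "s' = 1") (auto split: if_splits simp: of_bool_def)
qed

lemma Pslice_letter:
  assumes "1 \<le> r" "r \<le> per n"
  shows "Pslice n (letter n r) = r"
proof -
  consider "r = 1" | "2 \<le> r" "r \<le> n + 1" | "n + 2 \<le> r" using assms by linarith
  then show ?thesis using assms
  proof cases
    case 1 then show ?thesis by (simp add: Pslice_def letter_def)
  next
    case 2
    then have "(THE i. i \<in> {1..n} \<and> fst (letter n r) i = 1) = r - 1"
      by (intro the_equality) (auto simp: letter_def split: if_splits)
    moreover have "\<exists>i\<in>{1..n}. fst (letter n r) i = 1" using 2 by (intro bexI[of _ "r-1"]) (auto simp: letter_def)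
    ultimately show ?thesis using 2 unfolding Pslice_def by simp
  next
    case 3
    note 3 = 3 assms
    then have "(THE i. i \<in> {1..n} \<and> snd (letter n r) i = 1) = 2 * n + 2 - r"
      by (intro the_equality) (auto simp: letter_def per_def split: if_splits)
    moreover have "\<exists>i\<in>{1..n}. snd (letter n r) i = 1" using 3 by (intro bexI[of _ "2 * n + 2 - r"]) (auto simp: letter_def per_def)
    moreover have "\<not> (\<exists>i\<in>{1..n}. fst (letter n r) i = 1)" using 3 by (auto simp: letter_def)
    ultimately show ?thesis using 3 unfolding Pslice_def by (auto simp: Let_def per_def)
  qed
qed

subsection \<open>Equivalence of slices\<close>

text \<open>This invariant will separate the classes of slices; it induces the inverse of
  \<open>Phi\<close>.\<close>

definition content :: "nat \<Rightarrow> slice \<Rightarrow> celt" where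
  "content n C = word n (res n (fst C)) (res n (snd C))"

lemma content_in_Bcr: "C \<in> L1 n \<Longrightarrow> 1 \<le> n \<Longrightarrow> content n C \<in> Bcr n"
  using res_le res_ge by (cases C) (auto simp: content_def L1_iff intro!: word_in_Bcr)

lemma content_plus_delta [simp]: "content n (plus_delta n C) = content n C"
  by (simp add: content_def plus_delta_def word_commute)

lemma content_plus_delta_power [simp]: "content n ((plus_delta n ^^ k) C) = content n C"
  by (induction k) auto

lemma plus_delta_in_L1: "C \<in> L1 n \<Longrightarrow> 1 \<le> n \<Longrightarrow> plus_delta n C \<in> L1 n"
  by (cases C) (auto simp: plus_delta_def L1_iff)

lemma inj_plus_delta: "inj (plus_delta n)"
  by (auto simp: inj_def plus_delta_def prod_eq_iff)

text \<open>One shift exchanges the layers; two restore their order and raise each by a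
  period.\<close>

lemma plus_delta_power_even: "(plus_delta n ^^ (2 * k)) (a, b) = (per n * k + a, per n * k + b)"
  by (induction k) (auto simp: plus_delta_def)

lemma equiv_sim_rel: "equiv (L1 n) (sim_rel n)"
proof (rule equivI)
  show "sim_rel n \<subseteq> L1 n \<times> L1 n" by (auto simp: sim_rel_def)
  show "refl_on (L1 n) (sim_rel n)" by (auto simp: refl_on_def sim_rel_def intro: exI[of _ 0])
  show "sym (sim_rel n)" by (auto simp: sym_def sim_rel_def)
  \<comment> \<open>In transitivity the two shifts may have opposite directions. A common source
    reduces to a common image because powers commute, and a common image is handled by cancelling
    injective shifts.\<close>
  have cancel: "\<exists>j. x = (plus_delta n ^^ j) y \<or> y = (plus_delta n ^^ j) x"
    if "(plus_delta n ^^ k) x = (plus_delta n ^^ l) y" for k l x y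
    using that
  proof (induction k arbitrary: l)
    case 0 then show ?case by auto
  next
    case (Suc k)
    show ?case
    proof (cases l)
      case 0 with Suc.prems show ?thesis by (metis funpow_0)
    next
      case (Suc l')
      with Suc.prems have "(plus_delta n ^^ k) x = (plus_delta n ^^ l') y"
        using injD[OF inj_plus_delta] by auto
      then show ?thesis by (rule Suc.IH)
    qed
  qed
  show "trans (sim_rel n)"
  proof (rule transI)
    fix x y z assume xy: "(x, y) \<in> sim_rel n" and yz: "(y, z) \<in> sim_rel n"
    have "\<exists>j. z = (plus_delta n ^^ j) x \<or> x = (plus_delta n ^^ j) z"
    proof -
      obtain k l where "y = (plus_delta n ^^ k) x \<or> x = (plus_delta n ^^ k) y"
        "z = (plus_delta n ^^ l) y \<or> y = (plus_delta n ^^ l) z"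
        using xy yz by (auto simp: sim_rel_def)
      moreover have "(plus_delta n ^^ l) ((plus_delta n ^^ k) x) = (plus_delta n ^^ k) ((plus_delta n ^^ l) x)" for x
        by (metis add.commute comp_apply funpow_add)
      ultimately consider "z = (plus_delta n ^^ (l + k)) x" | "(plus_delta n ^^ k) x = (plus_delta n ^^ l) z"
        | "(plus_delta n ^^ l) x = (plus_delta n ^^ k) z" | "x = (plus_delta n ^^ (k + l)) z"
        unfolding funpow_add o_apply by blast
      then show ?thesis using cancel by cases blast+
    qed
    with xy yz show "(x, z) \<in> sim_rel n" by (auto simp: sim_rel_def)
  qed
qed

lemma sim_plus_delta_power:
  assumes "C \<in> L1 n" "1 \<le> n" shows "(C, (plus_delta n ^^ k) C) \<in> sim_rel n"
proof -
  have "(plus_delta n ^^ k) C \<in> L1 n" by (induction k) (use assms plus_delta_in_L1 in auto)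
  with assms show ?thesis by (auto simp: sim_rel_def)
qed

text \<open>With lengths \<open>per n * k + r\<close> and \<open>per n * l + s\<close>, the layer
  inequalities force \<open>l = k\<close> or \<open>l = k + 1\<close>. In the first case
  \<open>r \<le> s\<close> and \<open>2 * k\<close> shifts of the sorted pair give the slice; in the
  second \<open>s \<le> r\<close> and one more shift swaps the layers.\<close>

lemma sim_normal_form:
  assumes "(a, b) \<in> L1 n" "0 < a" "1 \<le> n" "r = res n a" "s = res n b"
  shows "((a, b), (min r s, max r s)) \<in> sim_rel n"
proof -
  have ab: "a \<le> b" "b \<le> a + per n" "r = 1 \<longleftrightarrow> s = 1" using assms by (auto simp: L1_iff)
  obtain k where k: "a = per n * k + r" using res_decomp assms by blast
  obtain l where l: "b = per n * l + s" using res_decomp assms ab by (metis less_le_trans)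
  have rng: "1 \<le> r" "r \<le> per n" "1 \<le> s" "s \<le> per n" using assms res_ge res_le by auto
  have m: "(min r s, max r s) \<in> L1 n" using ab rng assms(3) by (auto simp: L1_iff res_id min_def max_def)
  have "k \<le> l"
  proof (rule ccontr)
    assume "\<not> k \<le> l"
    then have "per n * Suc l \<le> per n * k" by (intro mult_le_mono2) simp
    then show False using ab(1) k l rng unfolding mult_Suc_right by linarith
  qed
  moreover have "l \<le> Suc k"
  proof (rule ccontr)
    assume "\<not> l \<le> Suc k"
    then have "per n * Suc (Suc k) \<le> per n * l" by (intro mult_le_mono2) simp
    then show False using ab(2) k l rng unfolding mult_Suc_right by linarith
  qed
  ultimately consider "l = k" | "l = Suc k" by linarith
  then have "\<exists>j. (a, b) = (plus_delta n ^^ j) (min r s, max r s)"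
  proof cases
    case 1 with k l ab have "(a, b) = (plus_delta n ^^ (2 * k)) (min r s, max r s)"
      unfolding plus_delta_power_even by auto
    then show ?thesis ..
  next
    case 2 with k l ab have "(a, b) = (plus_delta n ^^ Suc (2 * k)) (min r s, max r s)"
      unfolding funpow.simps o_apply plus_delta_power_even by (auto simp: plus_delta_def algebra_simps)
    then show ?thesis ..
  qed
  with m assms(1) show ?thesis by (auto simp: sim_rel_def)
qed

text \<open>Two shifts raise both layers by a whole period, which gives every class a member deep
  enough for \<open>res_decomp\<close> and for removing blocks.\<close>

lemma deep_member:
  assumes "C \<in> L1 n" "1 \<le> n"
  shows "(C, (plus_delta n ^^ 2) C) \<in> sim_rel n \<and> per n \<le> fst ((plus_delta n ^^ 2) C)"
  using sim_plus_delta_power[OF assms, of 2] by (simp add: plus_delta_def numeral_2_eq_2)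

text \<open>Shifts preserve content. Conversely, after raising both slices,
  \<open>word_inject\<close> gives the same unordered pair of residues, hence the same sorted normal
  form.\<close>

lemma sim_iff_content_eq:
  assumes "C \<in> L1 n" "D \<in> L1 n" "1 \<le> n"
  shows "(C, D) \<in> sim_rel n \<longleftrightarrow> content n C = content n D"
proof
  assume "(C, D) \<in> sim_rel n" then show "content n C = content n D" by (auto simp: sim_rel_def)
next
  have sym: "sym (sim_rel n)" and trans: "trans (sim_rel n)"
    using equiv_sim_rel[of n] by (auto elim: equivE)
  assume eq: "content n C = content n D"
  define C' D' where "C' = (plus_delta n ^^ 2) C" and "D' = (plus_delta n ^^ 2) D"
  have C': "(C, C') \<in> sim_rel n" "per n \<le> fst C'" and D': "(D, D') \<in> sim_rel n" "per n \<le> fst D'"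
    using deep_member assms by (auto simp: C'_def D'_def)
  have eq': "content n C' = content n D'" using eq by (simp add: C'_def D'_def)
  have L: "C' \<in> L1 n" "D' \<in> L1 n" using C' D' by (auto simp: sim_rel_def)
  obtain a b c d where CD: "C' = (a, b)" "D' = (c, d)" by fastforce
  have pos: "0 < a" "0 < c" using CD C' D' by (auto simp: per_def)
  have "res n a = res n c \<and> res n b = res n d \<or> res n a = res n d \<and> res n b = res n c"
    using eq' by (intro word_inject[of n]) (auto simp: content_def CD res_le intro: res_ge[simplified])
  then have "(min (res n a) (res n b), max (res n a) (res n b)) = (min (res n c) (res n d), max (res n c) (res n d))"
    by (auto simp: min.commute max.commute)
  then have "(C', D') \<in> sim_rel n"
    using sim_normal_form[of a b n] sim_normal_form[of c d n] L pos assms(3) CD sym trans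
    by (metis symD transD)
  with C' D' show "(C, D) \<in> sim_rel n"
    using sym trans by (metis symD transD)
qed

lemma content_surj:
  assumes "b \<in> Bcr n" "1 \<le> n"
  obtains r s where "1 \<le> r" "r \<le> s" "s \<le> per n" "(r, s) \<in> L1 n" "b = word n r s" "b = content n (r, s)"
proof -
  obtain r s where "1 \<le> r" "r \<le> s" "s \<le> per n" "r = 1 \<longleftrightarrow> s = 1" "b = word n r s"
    using assms(1) by (rule Bcr_imp_word)
  then show ?thesis using assms(2) that[of r s] by (simp add: L1_iff res_id content_def)
qed

lemma cls_eq_iff: "C \<in> L1 n \<Longrightarrow> D \<in> L1 n \<Longrightarrow> 1 \<le> n \<Longrightarrow> cls n C = cls n D \<longleftrightarrow> content n C = content n D"
  unfolding cls_def using eq_equiv_class_iff[OF equiv_sim_rel] sim_iff_content_eq by blast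

text \<open>The choice inside \<open>Phi\<close> is harmless: every eligible candidate has the given
  content, since adding a period or swapping layers does not change it, and content determines the
  class.\<close>

lemma Phi_content:
  assumes "C \<in> L1 n" "1 \<le> n" shows "Phi n (content n C) = cls n C"
proof -
  let ?Q = "\<lambda>D. D \<in> L1 n \<and> (\<exists>u v. u \<in> unitB n \<and> v \<in> unitB n \<and> celt_add u v = content n C \<and>
             D \<in> cands n (Pslice n u) (Pslice n v))"
  obtain r s where res: "1 \<le> r" "r \<le> s" "s \<le> per n" "(r, s) \<in> L1 n" "content n C = word n r s"
    using content_in_Bcr[OF assms] assms(2) by (rule content_surj)
  then have "(r, s) \<in> L1 n" "letter n r \<in> unitB n" "letter n s \<in> unitB n" "celt_add (letter n r) (letter n s) = content n C"
      "(r, s) \<in> cands n (Pslice n (letter n r)) (Pslice n (letter n s))"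
    by (auto simp: cands_def Pslice_letter letter_in_unitB word_def)
  then have "?Q (r, s)" by blast
  then have Q: "?Q (SOME D. ?Q D)" by (rule someI)
  have "content n D = content n C" if "?Q D" for D
  proof -
    from that obtain u v where uv: "u \<in> unitB n" "v \<in> unitB n" "celt_add u v = content n C"
      "D \<in> cands n (Pslice n u) (Pslice n v)" by blast
    obtain p where p: "1 \<le> p" "p \<le> per n" "u = letter n p" using uv(1) by (rule unitB_imp_letter)
    obtain q where q: "1 \<le> q" "q \<le> per n" "v = letter n q" using uv(2) by (rule unitB_imp_letter)
    have "content n D = word n p q" using uv(4) p q by (auto simp: cands_def Pslice_letter content_def res_id word_commute)
    then show ?thesis using uv p q by (simp add: word_def)
  qed
  with Q have "content n (SOME D. ?Q D) = content n C" "(SOME D. ?Q D) \<in> L1 n" by blast+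
  then show ?thesis unfolding Phi_def using assms cls_eq_iff by blast
qed

lemma bij_Phi: assumes "1 \<le> n" shows "bij_betw (Phi n) (Bcr n) (SQ n)"
proof (rule bij_betw_imageI)
  show "inj_on (Phi n) (Bcr n)"
  proof (rule inj_onI)
    fix b c assume bc: "b \<in> Bcr n" "c \<in> Bcr n" "Phi n b = Phi n c"
    obtain C where "C \<in> L1 n" "b = content n C" using bc(1) assms by (rule content_surj)
    moreover obtain D where "D \<in> L1 n" "c = content n D" using bc(2) assms by (rule content_surj)
    ultimately show "b = c" using bc(3) assms by (simp add: Phi_content cls_eq_iff)
  qed
  have "Phi n b \<in> SQ n" if b: "b \<in> Bcr n" for b
  proof -
    obtain C where "C \<in> L1 n" "b = content n C" by (rule content_surj[OF b assms])
    then show ?thesis using assms by (simp add: Phi_content SQ_def cls_def quotientI)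
  qed
  moreover have "X \<in> Phi n ` Bcr n" if X: "X \<in> SQ n" for X
  proof -
    obtain C where "C \<in> L1 n" "X = cls n C" using X by (auto simp: SQ_def cls_def elim: quotientE)
    then show ?thesis using assms Phi_content[of C n] content_in_Bcr[of C n] by (metis imageI)
  qed
  ultimately show "Phi n ` Bcr n = SQ n" by blast
qed

text \<open>Operators on classes act on a chosen deep representative; the later computations use
  only its content and its depth.\<close>

lemma deep_rep_Phi:
  assumes "b \<in> Bcr n" "1 \<le> n"
  shows "deep_rep n (Phi n b) \<in> L1 n \<and> per n \<le> fst (deep_rep n (Phi n b)) \<and> content n (deep_rep n (Phi n b)) = b"
proof -
  obtain C where C: "C \<in> L1 n" "b = content n C" using assms by (rule content_surj)
  have "\<exists>D. D \<in> cls n C \<and> per n \<le> fst D"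
    using deep_member[OF C(1) assms(2)] unfolding cls_def by blast
  then have "deep_rep n (Phi n b) \<in> cls n C \<and> per n \<le> fst (deep_rep n (Phi n b))"
    unfolding deep_rep_def C(2) Phi_content[OF C(1) assms(2)] by (rule someI_ex)
  moreover from this have "(C, deep_rep n (Phi n b)) \<in> sim_rel n" "deep_rep n (Phi n b) \<in> L1 n"
    by (simp_all add: cls_def sim_rel_def)
  ultimately show ?thesis using C sim_iff_content_eq[OF C(1) _ assms(2)] by metis
qed

subsection \<open>Operators on residues\<close>

lemma fst_letter: "1 \<le> j \<Longrightarrow> j \<le> n \<Longrightarrow> fst (letter n r) j = of_bool (r = j + 1)"
  and snd_letter: "1 \<le> j \<Longrightarrow> j \<le> n \<Longrightarrow> snd (letter n r) j = of_bool (r + j = per n + 1)"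
  by (auto simp: letter_def per_def)

lemma fst_word: "1 \<le> j \<Longrightarrow> j \<le> n \<Longrightarrow> fst (word n r s) j = of_bool (r = j + 1) + of_bool (s = j + 1)"
  and snd_word: "1 \<le> j \<Longrightarrow> j \<le> n \<Longrightarrow>
    snd (word n r s) j = of_bool (r + j = per n + 1) + of_bool (s + j = per n + 1)"
  using fst_letter[of j n] snd_letter[of j n] by (simp_all add: word_def celt_add_def)

lemma add_letter_unbarred:
  "celt_add (letter n r) c = ((fst c)(j := fst c j + 1), snd c)" if "1 \<le> j" "j \<le> n" "r = j + 1"
  using letter_unbarred[of j n] that by (auto simp: celt_add_def fun_eq_iff)

lemma add_letter_barred:
  "celt_add (letter n r) c = (fst c, (snd c)(j := snd c j + 1))" if "1 \<le> j" "j \<le> n" "r + j = per n + 1"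
proof -
  have "r = 2 * n + 2 - j" using that by (simp add: per_def)
  then show ?thesis using letter_barred[of j n] that by (auto simp: celt_add_def fun_eq_iff)
qed

lemma csum_fun_upd:
  assumes "1 \<le> i" "i \<le> n"
  shows "csum n (x(i := x i + d), y) = csum n (x, y) + d" "csum n (x, y(i := y i + d)) = csum n (x, y) + d"
proof -
  have "csum n (x(i := x i + d), y) = (\<Sum>j\<in>{1..n}. (x j + y j) + (if j = i then d else 0))"
    unfolding csum_def by (rule sum.cong) auto
  then show "csum n (x(i := x i + d), y) = csum n (x, y) + d"
    using assms by (simp add: sum.distrib csum_def)
  have "csum n (x, y(i := y i + d)) = (\<Sum>j\<in>{1..n}. (x j + y j) + (if j = i then d else 0))"
    unfolding csum_def by (rule sum.cong) auto
  then show "csum n (x, y(i := y i + d)) = csum n (x, y) + d"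
    using assms by (simp add: sum.distrib csum_def)
qed

lemma csum_word: "r \<le> per n \<Longrightarrow> s \<le> per n \<Longrightarrow> csum n (word n r s) = of_bool (2 \<le> r) + of_bool (2 \<le> s)"
  by (simp add: word_def csum_add csum_letter)

lemma inB_neg: "fst b j < 0 \<or> snd b j < 0 \<Longrightarrow> inB n b = None"
  by (auto simp: inB_def Bcr_def wellsupp_def) (meson not_le)+

text \<open>These are the residue pairs of level-1 slices and, read as letters, of elements of the
  crystal.\<close>

definition admissible :: "nat \<Rightarrow> nat \<Rightarrow> nat \<Rightarrow> bool" where
  "admissible n r s \<longleftrightarrow> 1 \<le> r \<and> 1 \<le> s \<and> r \<le> per n \<and> s \<le> per n \<and> (r = 1 \<longleftrightarrow> s = 1)"

lemma inB_word: "admissible n r s \<Longrightarrow> b = word n r s \<Longrightarrow> inB n b = Some (word n r s)"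
  using word_in_Bcr[of r n s] by (simp add: admissible_def inB_def)

lemma admissible_res: "(a, b) \<in> L1 n \<Longrightarrow> 1 \<le> n \<Longrightarrow> admissible n (res n a) (res n b)"
  using res_le res_ge by (auto simp: admissible_def L1_iff)

text \<open>The residue \<open>i + 1\<close> is the supporting \<open>i\<close>-slot and \<open>per n - i\<close> the covering one; they coincide
  for \<open>i = n\<close>.\<close>
definition f_res :: "nat \<Rightarrow> nat \<Rightarrow> nat \<Rightarrow> nat \<Rightarrow> (nat \<times> nat) option" where
  "f_res n i r s =
    (if i = 0 then
       (if r = 2 \<and> s = per n \<or> r = per n \<and> s = 2 then None
        else if r = 1 \<and> s = 1 then Some (2, 2)
        else if r = per n \<and> s = per n then Some (1, 1)
        else if r = per n then Some (2, s)
        else if s = per n then Some (r, 2)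
        else None)
     else if i < n \<and> (r = i + 2 \<and> s + i = per n \<or> r + i = per n \<and> s = i + 2) then None
     else if r + i = per n then Some (r + 1, s)
     else if s + i = per n then Some (r, s + 1)
     else if r = i + 1 then Some (r + 1, s)
     else if s = i + 1 then Some (r, s + 1)
     else None)"

text \<open>For \<open>i \<ge> 1\<close>, a column ending in an \<open>i\<close>-block has residue
  \<open>i + 2\<close> if that block is supporting and \<open>per n + 1 - i\<close> if it is
  covering. The priority is opposite to \<open>f_res\<close>: the supporting block goes
  first.\<close>

definition e_res :: "nat \<Rightarrow> nat \<Rightarrow> nat \<Rightarrow> nat \<Rightarrow> (nat \<times> nat) option" where
  "e_res n i r s =
    (if i = 0 then
       (if r = 2 \<and> s = per n \<or> r = per n \<and> s = 2 then None
        else if r = 1 \<and> s = 1 then Some (per n, per n)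
        else if r = 2 \<and> s = 2 then Some (1, 1)
        else if r = 2 then Some (per n, s)
        else if s = 2 then Some (r, per n)
        else None)
     else if i < n \<and> (r = i + 2 \<and> s + i = per n \<or> r + i = per n \<and> s = i + 2) then None
     else if r = i + 2 then Some (r - 1, s)
     else if s = i + 2 then Some (r, s - 1)
     else if r + i = per n + 1 then Some (r - 1, s)
     else if s + i = per n + 1 then Some (r, s - 1)
     else None)"

text \<open>Moves leave the crystal through a negative entry for \<open>i \<ge> 1\<close>, and
  through a sum above 2 for \<open>i = 0\<close>.\<close>

lemma inB_csum: "2 < csum n b \<Longrightarrow> inB n b = None"
  by (auto simp: inB_def Bcr_def)

section \<open>Lowering operators on words\<close>

lemma fB_covering:
  assumes "1 \<le> i" "i < n" "admissible n r s" "r + i = per n" "s \<noteq> i + 2"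
  shows "fB n i (word n r s) = Some (word n (r + 1) s)"
proof -
  obtain x y where c: "letter n s = (x, y)" by fastforce
  have U1: "word n r s = (x, y(i + 1 := y (i + 1) + 1))"
    using assms add_letter_barred[of "i + 1" n r "letter n s"] by (simp add: word_def c)
  have U2: "word n (r + 1) s = (x, y(i := y i + 1))"
    using assms add_letter_barred[of i n "r + 1" "letter n s"] by (simp add: word_def c)
  \<comment> \<open>\<open>r\<close> is the barred letter \<open>i + 1\<close> and \<open>s\<close>
    is not the unbarred one, so barred \<open>i + 1\<close> outnumbers unbarred \<open>i + 1\<close>
    in the word and \<open>fB\<close> takes its barred branch.\<close>
  have "x (i + 1) = 0" "0 \<le> y (i + 1)"
    using assms fst_letter[of "i + 1" n s] snd_letter[of "i + 1" n s] by (auto simp: c)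
  moreover have "admissible n (r + 1) s" using assms by (auto simp: admissible_def per_def)
  ultimately show ?thesis
    using assms(1,2) inB_word[OF _ U2[symmetric]] by (simp add: fB_def U1 fun_upd_idem)
qed

lemma fB_supporting:
  assumes "1 \<le> i" "i < n" "admissible n r s" "r = i + 1" "s + i \<noteq> per n"
  shows "fB n i (word n r s) = Some (word n (r + 1) s)"
proof -
  obtain x y where c: "letter n s = (x, y)" by fastforce
  have U1: "word n r s = (x(i := x i + 1), y)"
    using assms add_letter_unbarred[of i n r "letter n s"] by (simp add: word_def c)
  have U2: "word n (r + 1) s = (x(i + 1 := x (i + 1) + 1), y)"
    using assms add_letter_unbarred[of "i + 1" n "r + 1" "letter n s"] by (simp add: word_def c)
  have "0 \<le> x (i + 1)" "y (i + 1) = 0"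
    using assms fst_letter[of "i + 1" n s] snd_letter[of "i + 1" n s] by (auto simp: c)
  moreover have "admissible n (r + 1) s" using assms by (auto simp: admissible_def per_def)
  ultimately show ?thesis
    using assms(1,2) inB_word[OF _ U2[symmetric]] by (simp add: fB_def U1 fun_upd_idem)
qed

lemma fB_None:
  assumes "1 \<le> i" "i < n" "r \<noteq> i + 1" "s \<noteq> i + 1"
    "r + i = per n \<Longrightarrow> s = i + 2" "s + i = per n \<Longrightarrow> r = i + 2"
  shows "fB n i (word n r s) = None"
proof -
  obtain x y where c: "word n r s = (x, y)" by fastforce
  \<comment> \<open>The pair \<open>i + 2\<close>, \<open>per n - i\<close> falls here: both entries
    at \<open>i + 1\<close> are 1, the tie selects the unbarred branch, and the entry at
    \<open>i\<close> becomes -1. This is the crystal side of the splitting rule.\<close>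
  have "x i = 0" "y (i + 1) \<le> x (i + 1)"
    using assms fst_word[of i n r s] fst_word[of "i + 1" n r s] snd_word[of "i + 1" n r s] by (auto simp: c)
  then show ?thesis using assms(1,2) by (simp add: fB_def c) (rule inB_neg[of _ i], simp)
qed

lemma fB_n:
  assumes "1 \<le> n" "admissible n r s" "r = n + 1"
  shows "fB n n (word n r s) = Some (word n (r + 1) s)"
proof -
  obtain x y where c: "letter n s = (x, y)" by fastforce
  have U1: "word n r s = (x(n := x n + 1), y)"
    using assms add_letter_unbarred[of n n r "letter n s"] by (simp add: word_def c)
  have U2: "word n (r + 1) s = (x, y(n := y n + 1))"
    using assms add_letter_barred[of n n "r + 1" "letter n s"] by (simp add: word_def c per_def)
  have "admissible n (r + 1) s" using assms by (auto simp: admissible_def per_def)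
  then show ?thesis
    using assms(1) inB_word[OF _ U2[symmetric]] by (simp add: fB_def U1 fun_upd_idem)
qed

lemma fB_n_None:
  assumes "1 \<le> n" "r \<noteq> n + 1" "s \<noteq> n + 1"
  shows "fB n n (word n r s) = None"
proof -
  obtain x y where c: "word n r s = (x, y)" by fastforce
  have "x n = 0" using assms fst_word[of n n r s] by (auto simp: c)
  then show ?thesis using assms(1) by (simp add: fB_def c) (rule inB_neg[of _ n], simp)
qed

lemma fB_0_11:
  assumes "1 \<le> n" shows "fB n 0 (word n 1 1) = Some (word n 2 2)"
proof -
  have "word n 1 1 = (\<lambda>_. 0, \<lambda>_. 0)" by (simp add: word_def letter_def celt_add_def)
  moreover have "word n 2 2 = ((\<lambda>_. 0)(1 := 2), \<lambda>_. 0)"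
    using assms letter_unbarred[of 1 n] by (simp add: word_def numeral_2_eq_2 celt_add_def fun_eq_iff)
  moreover have "admissible n 2 2" using assms by (simp add: admissible_def per_def)
  ultimately show ?thesis using inB_word[of n 2 2] by (simp add: fB_def)
qed

lemma fB_0_PP:
  assumes "1 \<le> n" shows "fB n 0 (word n (per n) (per n)) = Some (word n 1 1)"
proof -
  have "word n 1 1 = (\<lambda>_. 0, \<lambda>_. 0)" by (simp add: word_def letter_def celt_add_def)
  moreover have "word n (per n) (per n) = (\<lambda>_. 0, (\<lambda>_. 0)(1 := 2))"
    using assms letter_barred[of 1 n] by (simp add: word_def per_def celt_add_def fun_eq_iff)
  moreover have "admissible n 1 1" using assms by (simp add: admissible_def per_def)
  ultimately show ?thesis using inB_word[of n 1 1] by (simp add: fB_def fun_upd_idem)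
qed

lemma fB_0_P:
  assumes "1 \<le> n" "admissible n r s" "r = per n" "s \<noteq> per n" "s \<noteq> 2"
  shows "fB n 0 (word n r s) = Some (word n 2 s)"
proof -
  obtain x y where c: "letter n s = (x, y)" by fastforce
  have U1: "word n r s = (x, y(1 := y 1 + 1))"
    using assms add_letter_barred[of 1 n r "letter n s"] by (simp add: word_def c)
  have U2: "word n 2 s = (x(1 := x 1 + 1), y)"
    using assms add_letter_unbarred[of 1 n 2 "letter n s"] by (simp add: word_def c)
  \<comment> \<open>The word thus has entries 0 and 1 at index 1, the middle branch of
    \<open>fB\<close>: barred 1 turns into unbarred 1, which for slices means two added
    0-blocks.\<close>
  have "x 1 = 0" "y 1 = 0"
    using assms fst_letter[of 1 n s] snd_letter[of 1 n s] by (auto simp: c)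
  moreover have "admissible n 2 s" using assms by (auto simp: admissible_def per_def)
  ultimately show ?thesis
    using inB_word[OF _ U2[symmetric]] by (simp add: fB_def U1 fun_upd_idem)
qed

lemma fB_0_None:
  assumes "1 \<le> n" "2 \<le> r" "2 \<le> s" "r \<le> per n" "s \<le> per n"
    "r = per n \<Longrightarrow> s = 2" "s = per n \<Longrightarrow> r = 2"
  shows "fB n 0 (word n r s) = None"
proof -
  obtain x y where c: "word n r s = (x, y)" by fastforce
  \<comment> \<open>So \<open>fB\<close> adds 2 to a sum that is already 2. The split pair
    \<open>2\<close>, \<open>per n\<close> falls here, with both entries 1.\<close>
  have "y 1 \<le> x 1"
    using assms fst_word[of 1 n r s] snd_word[of 1 n r s] by (auto simp: c)
  moreover have "csum n (x, y) = 2" using assms csum_word[of r n s] by (simp add: c)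
  then have "2 < csum n (x(1 := x 1 + 2), y)" using assms(1) csum_fun_upd(1)[where i=1 and n=n and x=x and y=y and d=2] by simp
  ultimately show ?thesis using inB_csum by (simp add: fB_def c)
qed

section \<open>Raising operators on words\<close>

lemma eB_supporting:
  assumes "1 \<le> i" "i < n" "admissible n r s" "r = i + 2" "s + i \<noteq> per n"
  shows "eB n i (word n r s) = Some (word n (r - 1) s)"
proof -
  obtain x y where c: "letter n s = (x, y)" by fastforce
  have U1: "word n r s = (x(i + 1 := x (i + 1) + 1), y)"
    using assms add_letter_unbarred[of "i + 1" n r "letter n s"] by (simp add: word_def c)
  have U2: "word n (r - 1) s = (x(i := x i + 1), y)"
    using assms add_letter_unbarred[of i n "r - 1" "letter n s"] by (simp add: word_def c)
  have "0 \<le> x (i + 1)" "y (i + 1) = 0"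
    using assms fst_letter[of "i + 1" n s] snd_letter[of "i + 1" n s] by (auto simp: c)
  moreover have "admissible n (r - 1) s" using assms by (auto simp: admissible_def per_def)
  ultimately show ?thesis
    using assms(1,2) inB_word[OF _ U2[symmetric]] by (simp add: eB_def U1 fun_upd_idem)
qed

lemma eB_covering:
  assumes "1 \<le> i" "i < n" "admissible n r s" "r + i = per n + 1" "s \<noteq> i + 2"
  shows "eB n i (word n r s) = Some (word n (r - 1) s)"
proof -
  obtain x y where c: "letter n s = (x, y)" by fastforce
  have U1: "word n r s = (x, y(i := y i + 1))"
    using assms add_letter_barred[of i n r "letter n s"] by (simp add: word_def c)
  have U2: "word n (r - 1) s = (x, y(i + 1 := y (i + 1) + 1))"
    using assms add_letter_barred[of "i + 1" n "r - 1" "letter n s"] by (simp add: word_def c per_def)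
  have "x (i + 1) = 0" "0 \<le> y (i + 1)"
    using assms fst_letter[of "i + 1" n s] snd_letter[of "i + 1" n s] by (auto simp: c)
  moreover have "admissible n (r - 1) s" using assms by (auto simp: admissible_def per_def)
  ultimately show ?thesis
    using assms(1,2) inB_word[OF _ U2[symmetric]] by (simp add: eB_def U1 fun_upd_idem)
qed

lemma eB_None:
  assumes "1 \<le> i" "i < n" "r + i \<noteq> per n + 1" "s + i \<noteq> per n + 1"
    "r = i + 2 \<Longrightarrow> s + i = per n" "s = i + 2 \<Longrightarrow> r + i = per n"
  shows "eB n i (word n r s) = None"
proof -
  obtain x y where c: "word n r s = (x, y)" by fastforce
  \<comment> \<open>Now a tie at \<open>i + 1\<close> selects the barred branch, which fails because
    \<open>y i = 0\<close>.\<close>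
  have "y i = 0" "x (i + 1) \<le> y (i + 1)"
    using assms snd_word[of i n r s] fst_word[of "i + 1" n r s] snd_word[of "i + 1" n r s] by (auto simp: c)
  then show ?thesis using assms(1,2) by (simp add: eB_def c) (rule inB_neg[of _ i], simp)
qed

lemma eB_n:
  assumes "1 \<le> n" "admissible n r s" "r = n + 2"
  shows "eB n n (word n r s) = Some (word n (r - 1) s)"
proof -
  obtain x y where c: "letter n s = (x, y)" by fastforce
  have U1: "word n r s = (x, y(n := y n + 1))"
    using assms add_letter_barred[of n n r "letter n s"] by (simp add: word_def c per_def)
  have U2: "word n (r - 1) s = (x(n := x n + 1), y)"
    using assms add_letter_unbarred[of n n "r - 1" "letter n s"] by (simp add: word_def c)
  have "admissible n (r - 1) s" using assms by (auto simp: admissible_def per_def)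
  then show ?thesis
    using assms(1) inB_word[OF _ U2[symmetric]] by (simp add: eB_def U1 fun_upd_idem)
qed

lemma eB_n_None:
  assumes "1 \<le> n" "r \<noteq> n + 2" "s \<noteq> n + 2"
  shows "eB n n (word n r s) = None"
proof -
  obtain x y where c: "word n r s = (x, y)" by fastforce
  have "y n = 0" using assms snd_word[of n n r s] by (auto simp: c per_def)
  then show ?thesis using assms(1) by (simp add: eB_def c) (rule inB_neg[of _ n], simp)
qed

lemma eB_0_11:
  assumes "1 \<le> n" shows "eB n 0 (word n 1 1) = Some (word n (per n) (per n))"
proof -
  have "word n 1 1 = (\<lambda>_. 0, \<lambda>_. 0)" by (simp add: word_def letter_def celt_add_def)
  moreover have "word n (per n) (per n) = (\<lambda>_. 0, (\<lambda>_. 0)(1 := 2))"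
    using assms letter_barred[of 1 n] by (simp add: word_def per_def celt_add_def fun_eq_iff)
  moreover have "admissible n (per n) (per n)" using assms by (simp add: admissible_def per_def)
  ultimately show ?thesis using inB_word[of n "per n" "per n"] by (simp add: eB_def)
qed

lemma eB_0_22:
  assumes "1 \<le> n" shows "eB n 0 (word n 2 2) = Some (word n 1 1)"
proof -
  have "word n 1 1 = (\<lambda>_. 0, \<lambda>_. 0)" by (simp add: word_def letter_def celt_add_def)
  moreover have "word n 2 2 = ((\<lambda>_. 0)(1 := 2), \<lambda>_. 0)"
    using assms letter_unbarred[of 1 n] by (simp add: word_def numeral_2_eq_2 celt_add_def fun_eq_iff)
  moreover have "admissible n 1 1" using assms by (simp add: admissible_def per_def)
  ultimately show ?thesis using inB_word[of n 1 1] by (simp add: eB_def fun_upd_idem)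
qed

lemma eB_0_2:
  assumes "1 \<le> n" "admissible n r s" "r = 2" "s \<noteq> per n" "s \<noteq> 2"
  shows "eB n 0 (word n r s) = Some (word n (per n) s)"
proof -
  obtain x y where c: "letter n s = (x, y)" by fastforce
  have U2: "word n (per n) s = (x, y(1 := y 1 + 1))"
    using assms add_letter_barred[of 1 n "per n" "letter n s"] by (simp add: word_def c)
  have U1: "word n r s = (x(1 := x 1 + 1), y)"
    using assms add_letter_unbarred[of 1 n 2 "letter n s"] by (simp add: word_def c)
  have "x 1 = 0" "y 1 = 0"
    using assms fst_letter[of 1 n s] snd_letter[of 1 n s] by (auto simp: c)
  moreover have "admissible n (per n) s" using assms by (auto simp: admissible_def per_def)
  ultimately show ?thesis
    using inB_word[OF _ U2[symmetric]] by (simp add: eB_def U1 fun_upd_idem)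
qed

lemma eB_0_None:
  assumes "1 \<le> n" "2 \<le> r" "2 \<le> s" "r \<le> per n" "s \<le> per n"
    "r = 2 \<Longrightarrow> s = per n" "s = 2 \<Longrightarrow> r = per n"
  shows "eB n 0 (word n r s) = None"
proof -
  obtain x y where c: "word n r s = (x, y)" by fastforce
  have "x 1 \<le> y 1"
    using assms fst_word[of 1 n r s] snd_word[of 1 n r s] by (auto simp: c)
  moreover have "csum n (x, y) = 2" using assms csum_word[of r n s] by (simp add: c)
  then have "2 < csum n (x, y(1 := y 1 + 2))" using assms(1) csum_fun_upd(2)[where i=1 and n=n and x=x and y=y and d=2] by simp
  ultimately show ?thesis using inB_csum by (simp add: eB_def c)
qed

section \<open>Crystal operators in terms of residues\<close>

lemma fB_word:
  assumes "2 \<le> n" "i \<le> n" "admissible n r s"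
  shows "fB n i (word n r s) = map_option (\<lambda>(p, q). word n p q) (f_res n i r s)"
proof -
  have sym: "admissible n s r" using assms by (auto simp: admissible_def)
  consider "i = 0" | "1 \<le> i" "i < n" | "i = n" "i \<noteq> 0" using assms by linarith
  then show ?thesis
  proof cases
    case 1
    then show ?thesis
      using assms fB_0_11[of n] fB_0_PP[of n] fB_0_P[of n r s] fB_0_P[of n s r] fB_0_None[of n r s] sym
      by (auto simp: f_res_def admissible_def word_commute per_def)
  next
    case 2
    \<comment> \<open>The supporting slot \<open>i + 1\<close> and the covering slot
      \<open>per n - i\<close> differ for \<open>i < n\<close>, which keeps the branches of
      \<open>f_res\<close> apart.\<close>
    then have "Suc (i + i) \<noteq> per n" by (simp add: per_def)
    then show ?thesis using 2 assms(3)
      fB_covering[of i n r s] fB_covering[of i n s r] fB_supporting[of i n r s] fB_supporting[of i n s r]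
        fB_None[of i n r s] sym word_commute[of n r s] word_commute[of n r "s + 1"]
      unfolding f_res_def by auto
  next
    case 3
    then show ?thesis
      using assms(1,3) fB_n[of n r s] fB_n[of n s r] fB_n_None[of n r s] sym word_commute[of n r s] word_commute[of n r "s + 1"]
      unfolding f_res_def per_def by auto
  qed
qed

lemma eB_word:
  assumes "2 \<le> n" "i \<le> n" "admissible n r s"
  shows "eB n i (word n r s) = map_option (\<lambda>(p, q). word n p q) (e_res n i r s)"
proof -
  have sym: "admissible n s r" using assms by (auto simp: admissible_def)
  consider "i = 0" | "1 \<le> i" "i < n" | "i = n" "i \<noteq> 0" using assms by linarith
  then show ?thesis
  proof cases
    case 1
    then show ?thesis
      using assms eB_0_11[of n] eB_0_22[of n] eB_0_2[of n r s] eB_0_2[of n s r] eB_0_None[of n r s] sym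
      by (auto simp: e_res_def admissible_def word_commute per_def)
  next
    case 2
    then have "Suc (i + i) \<noteq> per n" by (simp add: per_def)
    then show ?thesis using 2 assms(3)
      eB_covering[of i n r s] eB_covering[of i n s r] eB_supporting[of i n r s] eB_supporting[of i n s r]
        eB_None[of i n r s] sym word_commute[of n r s] word_commute[of n r "s - 1"]
      unfolding e_res_def by auto
  next
    case 3
    then show ?thesis
      using assms(1,3) eB_n[of n r s] eB_n[of n s r] eB_n_None[of n r s] sym word_commute[of n r s] word_commute[of n r "s - 1"]
      unfolding e_res_def per_def by auto
  qed
qed

subsection \<open>Slice operators\<close>

text \<open>In letters, one layer is barred \<open>i + 1\<close> and the other unbarred
  \<open>i + 1\<close>. Taking \<open>i = 0\<close> covers the 1-blocks that obstruct the
  0-operators.\<close>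

lemma can_split_res:
  assumes "2 \<le> n" "i < n" "0 < a" "0 < b"
  shows "can_split n (i + 1) (a, b) \<longleftrightarrow>
    res n a + i = per n \<and> res n b = i + 2 \<or> res n a = i + 2 \<and> res n b + i = per n"
proof -
  have split1: "split1 n (i + 1) m m' \<longleftrightarrow> res n m + i = per n \<and> res n m' = i + 2" if "0 < m" for m m'
  proof -
    have top: "topis n (i + 1) m \<longleftrightarrow> res n m = i + 3 \<or> res n m + i = per n"
      using assms(1,2) that res_le[of n m] res_ge[of n m] by (auto simp: topis_res per_def)
    have cov: "covr n (m - 1) \<longleftrightarrow> res n m = 1 \<or> res n m = 2 \<or> n + 2 \<le> res n m"
      using assms(1,2) that res_le[of n m] res_ge[of n m] res_pred[of m n] covr_res[of n "m - 1"]
      by (auto simp: per_def)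
    have col: "col n m' = i + 1 \<longleftrightarrow> res n m' = i + 2 \<or> res n m' + i + 1 = per n"
      using assms(1,2) res_le[of n m'] res_ge[of n m'] by (auto simp: col_res per_def)
    have sup: "supp n m' \<longleftrightarrow> 2 \<le> res n m' \<and> res n m' \<le> n + 1"
      using assms(1) by (simp add: supp_res)
    show ?thesis
    \<comment> \<open>For \<open>i + 1 = n\<close> the two alternatives in \<open>top\<close>
      coincide, as do those in \<open>col\<close>, so the clause for \<open>n\<close>-blocks yields
      the same residues.\<close>
    proof (cases "i + 1 < n")
      case True
      then have "split1 n (i + 1) m m' \<longleftrightarrow>
          topis n (i + 1) m \<and> covr n (m - 1) \<and> col n m' = i + 1 \<and> supp n m'"
        by (simp add: split1_def)
      then show ?thesis using True unfolding top cov col sup per_def by linarith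
    next
      case False
      then have "split1 n (i + 1) m m' \<longleftrightarrow> topis n (i + 1) m \<and> col n m' = i + 1"
        using assms(2) by (simp add: split1_def) (metis Suc_leI le_antisym not_less)
      then show ?thesis using False assms(2) unfolding top col per_def by linarith
    qed
  qed
  show ?thesis using assms split1[of a b] split1[of b a] by (auto simp: can_split_def)
qed

lemma col_eq_iff:
  assumes "1 \<le> i" "i \<le> n"
  shows "col n a = i \<longleftrightarrow> res n a = i + 1 \<or> res n a + i = per n"
  using assms res_le[of n a] res_ge[of n a] by (auto simp: col_res per_def)

lemma col_eq_0_iff: "col n a = 0 \<longleftrightarrow> res n a = 1 \<or> res n a = per n"
  using res_le[of n a] res_ge[of n a] by (auto simp: col_res)

lemma topis_iff:
  assumes "1 \<le> i" "i \<le> n" "0 < a"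
  shows "topis n i a \<longleftrightarrow> res n a = i + 2 \<or> res n a + i = per n + 1"
  using assms res_le[of n a] res_ge[of n a] by (auto simp: topis_res per_def)

lemma topis_0_iff: "0 < a \<Longrightarrow> 1 \<le> n \<Longrightarrow> topis n 0 a \<longleftrightarrow> res n a = 1 \<or> res n a = 2"
  using res_le[of n a] res_ge[of n a] by (auto simp: topis_res per_def)

section \<open>Adding or removing a single block\<close>

lemma map_chk: "C \<in> L1 n \<Longrightarrow> content n C = b \<Longrightarrow> map_option (content n) (chk n C) = Some b"
  by (simp add: chk_def)

text \<open>The bounds keep the residue different from 1 before and after the step, so parity
  persists; \<open>a \<noteq> b\<close> leaves room below the second layer.\<close>

lemma add_left:
  assumes "(a, b) \<in> L1 n" "1 \<le> n" "res n a < per n" "2 \<le> res n a" "a \<noteq> b"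
  shows "map_option (content n) (chk n (a + 1, b)) = Some (word n (res n a + 1) (res n b))"
  using assms by (intro map_chk) (auto simp: L1_iff content_def res_Suc)

lemma add_right:
  assumes "(a, b) \<in> L1 n" "1 \<le> n" "res n b < per n" "2 \<le> res n b" "b \<noteq> a + per n"
  shows "map_option (content n) (chk n (a, b + 1)) = Some (word n (res n a) (res n b + 1))"
  using assms by (intro map_chk) (auto simp: L1_iff content_def res_Suc)

text \<open>Shrinking the first layer widens the gap, so the bound \<open>b \<le> a + per n\<close>
  must be strict; a residue of at least 3 does not drop to 1.\<close>

lemma remove_left:
  assumes "(a, b) \<in> L1 n" "1 \<le> n" "3 \<le> res n a" "0 < a" "b \<noteq> a + per n"
  shows "map_option (content n) (chk n (a - 1, b)) = Some (word n (res n a - 1) (res n b))"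
  using assms res_pred[of a n] by (intro map_chk) (auto simp: L1_iff content_def)

lemma remove_right:
  assumes "(a, b) \<in> L1 n" "1 \<le> n" "3 \<le> res n b" "0 < b" "a \<noteq> b"
  shows "map_option (content n) (chk n (a, b - 1)) = Some (word n (res n a) (res n b - 1))"
  using assms res_pred[of b n] by (intro map_chk) (auto simp: L1_iff content_def)

section \<open>Slice operators in terms of residues\<close>

lemma sf_content_pos:
  assumes "2 \<le> n" "1 \<le> i" "i \<le> n" "(a, b) \<in> L1 n" "0 < a"
  shows "map_option (content n) (sf n i (a, b)) = map_option (\<lambda>(p, q). word n p q) (f_res n i (res n a) (res n b))"
proof -
  define r s where "r = res n a" and "s = res n b"
  have "0 < b" using assms by (auto simp: L1_def)
  have split: "i < n \<and> can_split n (i + 1) (a, b) \<longleftrightarrow>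
      i < n \<and> (r + i = per n \<and> s = i + 2 \<or> r = i + 2 \<and> s + i = per n)"
    using can_split_res[of n i a b] assms \<open>0 < b\<close> by (auto simp: r_def s_def)
  have col: "col n a = i \<longleftrightarrow> r = i + 1 \<or> r + i = per n" "col n b = i \<longleftrightarrow> s = i + 1 \<or> s + i = per n"
    using col_eq_iff assms by (simp_all add: r_def s_def)
  have less: "i + 1 < per n" "r + i = per n \<Longrightarrow> r < per n \<and> 2 \<le> r" "s + i = per n \<Longrightarrow> s < per n \<and> 2 \<le> s"
    using assms by (auto simp: per_def)
  have left: "map_option (content n) (chk n (a + 1, b)) = Some (word n (r + 1) s)"
    if "col n a = i" "a \<noteq> b"
    using add_left[of a b n] that assms less col by (auto simp: r_def s_def)
  have right: "map_option (content n) (chk n (a, b + 1)) = Some (word n r (s + 1))"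
    if "col n b = i" "b \<noteq> a + per n"
    using add_right[of a b n] that assms less col by (auto simp: r_def s_def)
  have neq: "a \<noteq> b" "b \<noteq> a + per n" if "r \<noteq> s"
    using that by (auto simp: r_def s_def)
  \<comment> \<open>Two \<open>i\<close>-slots of the same kind have the same residue, and for
    \<open>i = n\<close> only one residue is possible, so the rule's case distinction becomes
    \<open>r = s\<close>.\<close>
  have kind: "i = n \<or> supp n a = supp n b \<longleftrightarrow> r = s" "covr n a \<longleftrightarrow> i = n \<or> r + i = per n"
    if "col n a = i" "col n b = i"
    using that assms(1-3) col supp_res[of n a] supp_res[of n b] covr_res[of n a]
    unfolding r_def[symmetric] s_def[symmetric] by (auto simp: per_def)
  show ?thesis
  proof (cases "i < n \<and> can_split n (i + 1) (a, b)")
    case True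
    then show ?thesis using assms(2) split unfolding sf_def f_res_def r_def[symmetric] s_def[symmetric] by auto
  next
    case False
    then have sf: "sf n i (a, b) =
      (if col n a \<noteq> i \<and> col n b \<noteq> i then None
       else if col n a = i \<and> col n b \<noteq> i then chk n (a + 1, b)
       else if col n a \<noteq> i \<and> col n b = i then chk n (a, b + 1)
       else if r = s then if a \<noteq> b then chk n (a + 1, b) else chk n (a, b + 1)
       else if i = n \<or> r + i = per n then chk n (a + 1, b) else chk n (a, b + 1))"
      using assms(2,3) kind unfolding sf_def hgt_eq_iff by auto
    have f_res: "f_res n i r s =
       (if r + i = per n then Some (r + 1, s)
        else if s + i = per n then Some (r, s + 1)
        else if r = i + 1 then Some (r + 1, s)
        else if s = i + 1 then Some (r, s + 1) else None)"
      using False split assms(2) unfolding f_res_def by auto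
    consider "col n a \<noteq> i" "col n b \<noteq> i" | "col n a = i" "col n b \<noteq> i" | "col n a \<noteq> i" "col n b = i"
      | "col n a = i" "col n b = i" "r = s" | "col n a = i" "col n b = i" "r \<noteq> s" by blast
    then have "map_option (content n) (sf n i (a, b)) = map_option (\<lambda>(p, q). word n p q) (f_res n i r s)"
    proof cases
      case 1
      then have "sf n i (a, b) = None" "f_res n i r s = None" using col by (simp_all add: sf f_res)
      then show ?thesis by simp
    next
      case 2
      then have "sf n i (a, b) = chk n (a + 1, b)" "f_res n i r s = Some (r + 1, s)" "r \<noteq> s"
        using col by (simp_all add: sf f_res) blast+
      then show ?thesis using left[OF 2(1)] neq by simp
    next
      case 3
      then have "sf n i (a, b) = chk n (a, b + 1)" "f_res n i r s = Some (r, s + 1)" "r \<noteq> s"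
        using col by (simp_all add: sf f_res) blast+
      then show ?thesis using right[OF 3(2)] neq by simp
    next
      case 4
      then have *: "f_res n i r s = Some (r + 1, s)" "sf n i (a, b) = (if a \<noteq> b then chk n (a + 1, b) else chk n (a, b + 1))"
        using f_res sf col by auto
      \<comment> \<open>Equal residues mean equal lengths or lengths one period apart. The height
        rule picks the layer that can grow, and by commutativity both outcomes give the same
        word.\<close>
      show ?thesis
      proof (cases "a = b")
        case True
        then have "b \<noteq> a + per n" by (simp add: per_def)
        then show ?thesis using right[OF 4(2)] * True 4(3) word_commute[of n s "s + 1"] by simp
      next
        case False
        then show ?thesis using left[OF 4(1)] * by simp
      qed
    next
      case 5
      consider "r + i = per n" "s = i + 1" | "s + i = per n" "r = i + 1" "r + i \<noteq> per n" using 5 col by auto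
      then show ?thesis
      proof cases
        case 1
        then have "sf n i (a, b) = chk n (a + 1, b)" "f_res n i r s = Some (r + 1, s)"
          using 5 1 sf f_res by simp_all
        then show ?thesis using left[OF 5(1)] neq 5(3) by simp
      next
        case 2
        then have "i \<noteq> n" using 5(3) by (auto simp: per_def)
        then have "sf n i (a, b) = chk n (a, b + 1)" "f_res n i r s = Some (r, s + 1)"
          using 5 2 sf f_res by simp_all
        then show ?thesis using right[OF 5(2)] neq 5(3) by simp
      qed
    qed
    then show ?thesis by (simp add: r_def s_def)
  qed
qed

lemma se_content_pos:
  assumes "2 \<le> n" "1 \<le> i" "i \<le> n" "(a, b) \<in> L1 n" "0 < a"
  shows "map_option (content n) (se n i (a, b)) = map_option (\<lambda>(p, q). word n p q) (e_res n i (res n a) (res n b))"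
proof -
  define r s where "r = res n a" and "s = res n b"
  have "0 < b" using assms by (auto simp: L1_def)
  have split: "i < n \<and> can_split n (i + 1) (a, b) \<longleftrightarrow>
      i < n \<and> (r + i = per n \<and> s = i + 2 \<or> r = i + 2 \<and> s + i = per n)"
    using can_split_res[of n i a b] assms \<open>0 < b\<close> by (auto simp: r_def s_def)
  have col: "topis n i a \<longleftrightarrow> r = i + 2 \<or> r + i = per n + 1" "topis n i b \<longleftrightarrow> s = i + 2 \<or> s + i = per n + 1"
    using topis_iff assms \<open>0 < b\<close> by (simp_all add: r_def s_def)
  have less: "r + i = per n + 1 \<Longrightarrow> 3 \<le> r" "s + i = per n + 1 \<Longrightarrow> 3 \<le> s"
    using assms by (auto simp: per_def)
  have left: "map_option (content n) (chk n (a - 1, b)) = Some (word n (r - 1) s)"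
    if "topis n i a" "b \<noteq> a + per n"
    using remove_left[of a b n] that assms less col by (auto simp: r_def s_def)
  have right: "map_option (content n) (chk n (a, b - 1)) = Some (word n r (s - 1))"
    if "topis n i b" "a \<noteq> b"
    using remove_right[of a b n] that assms less col \<open>0 < b\<close> by (auto simp: r_def s_def)
  have neq: "a \<noteq> b" "b \<noteq> a + per n" if "r \<noteq> s"
    using that by (auto simp: r_def s_def)
  \<comment> \<open>The kind is that of position \<open>m - 1\<close>, which shifts the bound by
    one. The covering residue \<open>per n + 1 - i\<close> exceeds \<open>n + 2\<close> unless
    \<open>i = n\<close>, where it equals \<open>i + 2\<close>.\<close>
  have supp_top: "supp n (m - 1) \<longleftrightarrow> res n m = i + 2" if "topis n i m" "0 < m" for m
  proof -
    have m: "res n m = i + 2 \<or> res n m + i = per n + 1" using that topis_iff assms(2,3) by simp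
    then have "3 \<le> res n m" using assms(2,3) by (auto simp: per_def)
    then have "supp n (m - 1) \<longleftrightarrow> res n m \<le> n + 2"
      using supp_res[of n "m - 1"] res_pred[of m n] that assms(1) by auto
    also have "\<dots> \<longleftrightarrow> res n m = i + 2" using m assms(2,3) unfolding per_def by linarith
    finally show ?thesis .
  qed
  have kind: "i = n \<or> supp n (a - 1) = supp n (b - 1) \<longleftrightarrow> r = s" "supp n (a - 1) \<longleftrightarrow> r = i + 2"
    if "topis n i a" "topis n i b"
  proof -
    show "supp n (a - 1) \<longleftrightarrow> r = i + 2" using supp_top that(1) \<open>0 < a\<close> by (simp add: r_def)
    have "i = n \<Longrightarrow> r = s" using that unfolding col per_def by linarith
    moreover have "(r = i + 2 \<longleftrightarrow> s = i + 2) \<longleftrightarrow> r = s" using that unfolding col by linarith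
    ultimately show "i = n \<or> supp n (a - 1) = supp n (b - 1) \<longleftrightarrow> r = s"
      using supp_top that \<open>0 < a\<close> \<open>0 < b\<close> by (auto simp: r_def s_def)
  qed
  have pred: "a - 1 = b - 1 \<longleftrightarrow> a = b" using \<open>0 < a\<close> \<open>0 < b\<close> by auto
  show ?thesis
  proof (cases "i < n \<and> can_split n (i + 1) (a, b)")
    case True
    then show ?thesis using assms(2) split unfolding se_def e_res_def r_def[symmetric] s_def[symmetric] by auto
  next
    case False
    then have se: "se n i (a, b) =
      (if \<not> topis n i a \<and> \<not> topis n i b then None
       else if topis n i a \<and> \<not> topis n i b then chk n (a - 1, b)
       else if \<not> topis n i a \<and> topis n i b then chk n (a, b - 1)
       else if r = s then if a \<noteq> b then chk n (a, b - 1) else chk n (a - 1, b)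
       else if r = i + 2 then chk n (a - 1, b) else chk n (a, b - 1))"
      using assms(2,3) kind unfolding se_def prod.case hgt_eq_iff pred by auto
    have e_res: "e_res n i r s =
       (if r = i + 2 then Some (r - 1, s)
        else if s = i + 2 then Some (r, s - 1)
        else if r + i = per n + 1 then Some (r - 1, s)
        else if s + i = per n + 1 then Some (r, s - 1) else None)"
      using False split assms(2) unfolding e_res_def by auto
    consider "\<not> topis n i a" "\<not> topis n i b" | "topis n i a" "\<not> topis n i b" | "\<not> topis n i a" "topis n i b"
      | "topis n i a" "topis n i b" "r = s" | "topis n i a" "topis n i b" "r \<noteq> s" by blast
    then have "map_option (content n) (se n i (a, b)) = map_option (\<lambda>(p, q). word n p q) (e_res n i r s)"
    proof cases
      case 1
      then have "se n i (a, b) = None" "e_res n i r s = None" using col by (simp_all add: se e_res)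
      then show ?thesis by simp
    next
      case 2
      then have "se n i (a, b) = chk n (a - 1, b)" "e_res n i r s = Some (r - 1, s)" "r \<noteq> s"
        using col by (simp_all add: se e_res) blast+
      then show ?thesis using left[OF 2(1)] neq by simp
    next
      case 3
      then have "se n i (a, b) = chk n (a, b - 1)" "e_res n i r s = Some (r, s - 1)" "r \<noteq> s"
        using col by (simp_all add: se e_res) blast+
      then show ?thesis using right[OF 3(2)] neq by simp
    next
      case 4
      then have *: "e_res n i r s = Some (r - 1, s)" "se n i (a, b) = (if a \<noteq> b then chk n (a, b - 1) else chk n (a - 1, b))"
        using e_res se col by auto
      \<comment> \<open>Dually, equal layers must shrink in the first, layers one period apart in
        the second.\<close>
      show ?thesis
      proof (cases "a = b")
        case True
        then have "b \<noteq> a + per n" by (simp add: per_def)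
        then show ?thesis using left[OF 4(1)] * True by simp
      next
        case False
        then show ?thesis using right[OF 4(2)] * 4(3) word_commute[of n s "s - 1"] by simp
      qed
    next
      case 5
      consider "r = i + 2" | "s = i + 2" "r + i = per n + 1" "r \<noteq> i + 2" using 5 col by auto
      then show ?thesis
      proof cases
        case 1
        then have "se n i (a, b) = chk n (a - 1, b)" "e_res n i r s = Some (r - 1, s)"
          using 5 1 se e_res by simp_all
        then show ?thesis using left[OF 5(1)] neq 5(3) by simp
      next
        case 2
        then have "se n i (a, b) = chk n (a, b - 1)" "e_res n i r s = Some (r, s - 1)"
          using 5 2 se e_res by simp_all
        then show ?thesis using right[OF 5(2)] neq 5(3) by simp
      qed
    qed
    then show ?thesis by (simp add: r_def s_def)
  qed
qed

lemma sf_content_0: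
  assumes "2 \<le> n" "(a, b) \<in> L1 n" "0 < a"
  shows "map_option (content n) (sf n 0 (a, b)) = map_option (\<lambda>(p, q). word n p q) (f_res n 0 (res n a) (res n b))"
proof -
  have "0 < b" using assms by (auto simp: L1_def)
  note split = can_split_res[of n 0 a b, simplified]
  note admissible = admissible_res[OF assms(2)]
  \<comment> \<open>\<open>S\<close> is the split pair; in \<open>P\<close> and \<open>P'\<close>
    exactly one layer has a 0-slot, in \<open>N\<close> none. Residue 1 occurs in both layers or in
    neither, which leaves no other case.\<close>
  consider (S) "res n a = per n \<and> res n b = 2 \<or> res n a = 2 \<and> res n b = per n"
    | (11) "res n a = 1" "res n b = 1" | (PP) "res n a = per n" "res n b = per n"
    | (P) "res n a = per n" "res n b \<noteq> 1" "res n b \<noteq> 2" "res n b \<noteq> per n"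
    | (P') "res n b = per n" "res n a \<noteq> 1" "res n a \<noteq> 2" "res n a \<noteq> per n"
    | (N) "res n a \<noteq> 1" "res n b \<noteq> 1" "res n a \<noteq> per n" "res n b \<noteq> per n"
    using assms admissible unfolding admissible_def by auto
  then show ?thesis
  proof cases
    case S then show ?thesis using split assms \<open>0 < b\<close> by (auto simp: sf_def f_res_def)
  next
    case 11
    then have "map_option (content n) (chk n (a + 1, b + 1)) = Some (word n 2 2)"
      using assms by (intro map_chk) (auto simp: L1_iff res_Suc content_def per_def numeral_2_eq_2)
    then show ?thesis using split assms \<open>0 < b\<close> 11 by (auto simp: sf_def f_res_def col_eq_0_iff per_def)
  next
    case PP
    then have "map_option (content n) (chk n (a + 1, b + 1)) = Some (word n 1 1)"
      using assms by (intro map_chk) (auto simp: L1_iff res_Suc content_def)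
    then show ?thesis using split assms \<open>0 < b\<close> PP by (auto simp: sf_def f_res_def col_eq_0_iff per_def)
  next
    case P
    \<comment> \<open>Growing by two requires excluding \<open>b = a\<close> and
      \<open>b = a + 1\<close>; residues do so, since \<open>a + 1\<close> has residue 1 and
      \<open>b\<close> does not.\<close>
    then have "a \<noteq> b" "a + 1 \<noteq> b" and "res n (a + 2) = 2"
      using res_Suc[of n a] res_Suc[of n "Suc a"] assms(1) by (auto simp: per_def numeral_2_eq_2)
    then have "map_option (content n) (chk n (a + 2, b)) = Some (word n 2 (res n b))"
      using assms(1,2) P by (intro map_chk) (auto simp: L1_iff content_def)
    then show ?thesis using split assms \<open>0 < b\<close> P by (auto simp: sf_def f_res_def col_eq_0_iff)
  next
    case P'
    have "per n \<noteq> 1" using assms(1) by (simp add: per_def)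
    then have Suc: "res n (b + 1) = 1" and "res n (b + 2) = 2"
      using P'(1) res_Suc[of n b] res_Suc[of n "Suc b"] assms(1) by simp_all
    then have "res n (a + per n) \<noteq> res n b" "res n (a + per n) \<noteq> res n (b + 1)"
      using P' unfolding res_add_per Suc by auto
    then have "a + per n \<noteq> b" "a + per n \<noteq> b + 1" by metis+
    then have "map_option (content n) (chk n (a, b + 2)) = Some (word n (res n a) 2)"
      using assms(1,2) P' \<open>res n (b + 2) = 2\<close> by (intro map_chk) (auto simp: L1_iff content_def)
    then show ?thesis using split assms \<open>0 < b\<close> P' by (auto simp: sf_def f_res_def col_eq_0_iff)
  next
    case N then show ?thesis using split assms \<open>0 < b\<close> by (auto simp: sf_def f_res_def col_eq_0_iff)
  qed
qed

text \<open>With \<open>2 \<le> a\<close>, hence \<open>2 \<le> b\<close>, removing two 0-blocks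
  from a layer is exact subtraction.\<close>

lemma se_content_0:
  assumes "2 \<le> n" "(a, b) \<in> L1 n" "2 \<le> a"
  shows "map_option (content n) (se n 0 (a, b)) = map_option (\<lambda>(p, q). word n p q) (e_res n 0 (res n a) (res n b))"
proof -
  have pos: "0 < a" "0 < b" "2 \<le> b" using assms by (auto simp: L1_def)
  note split = can_split_res[of n 0 a b, simplified]
  note admissible = admissible_res[OF assms(2)]
  have pa: "res n (a - 1) = (if res n a = 1 then per n else res n a - 1)"
    "res n (b - 1) = (if res n b = 1 then per n else res n b - 1)"
    "res n (a - 2) = (if res n (a - 1) = 1 then per n else res n (a - 1) - 1)"
    "res n (b - 2) = (if res n (b - 1) = 1 then per n else res n (b - 1) - 1)"
    using res_pred[of a n] res_pred[of b n] res_pred[of "a - 1" n] res_pred[of "b - 1" n] assms pos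
    by (simp_all add: numeral_2_eq_2)
  have le: "a - 1 \<le> b - 1" "b - 1 \<le> a - 1 + per n" using assms(2,3) by (auto simp: L1_def)
  consider (S) "res n a = per n \<and> res n b = 2 \<or> res n a = 2 \<and> res n b = per n"
    | (11) "res n a = 1" "res n b = 1" | (22) "res n a = 2" "res n b = 2"
    | (P) "res n a = 2" "res n b \<noteq> 1" "res n b \<noteq> 2" "res n b \<noteq> per n"
    | (P') "res n b = 2" "res n a \<noteq> 1" "res n a \<noteq> 2" "res n a \<noteq> per n"
    | (N) "res n a \<noteq> 1" "res n b \<noteq> 1" "res n a \<noteq> 2" "res n b \<noteq> 2"
    using assms admissible unfolding admissible_def by auto
  then show ?thesis
  proof cases
    case S then show ?thesis using split assms pos by (auto simp: se_def e_res_def)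
  next
    case 11
    then have "map_option (content n) (chk n (a - 1, b - 1)) = Some (word n (per n) (per n))"
      using assms(1) le pa(1,2) by (intro map_chk) (simp_all add: L1_iff content_def)
    then show ?thesis using split assms pos 11 by (auto simp: se_def e_res_def topis_0_iff per_def)
  next
    case 22
    then have "map_option (content n) (chk n (a - 1, b - 1)) = Some (word n 1 1)"
      using assms(1) le pa(1,2) by (intro map_chk) (simp_all add: L1_iff content_def)
    then show ?thesis using split assms pos 22 by (auto simp: se_def e_res_def topis_0_iff per_def)
  next
    case P
    then have res: "res n (a - 1) = 1" "res n (a - 2) = per n" using pa by simp_all
    then have "res n b \<noteq> res n (a + per n)" "res n b \<noteq> res n (a - 1 + per n)"
      using P unfolding res_add_per res by auto
    then have "b \<noteq> a + per n" "b \<noteq> a - 1 + per n" by metis+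
    then have "map_option (content n) (chk n (a - 2, b)) = Some (word n (per n) (res n b))"
      using assms P res by (intro map_chk) (auto simp: L1_iff content_def)
    then show ?thesis using split assms pos P by (auto simp: se_def e_res_def topis_0_iff)
  next
    case P'
    then have res: "res n (b - 1) = 1" "res n (b - 2) = per n" using pa by simp_all
    then have "b \<noteq> a" "b - 1 \<noteq> a" using P' by auto
    then have "map_option (content n) (chk n (a, b - 2)) = Some (word n (res n a) (per n))"
      using assms P' res by (intro map_chk) (auto simp: L1_iff content_def)
    then show ?thesis using split assms pos P' by (auto simp: se_def e_res_def topis_0_iff)
  next
    case N then show ?thesis using split assms pos by (auto simp: se_def e_res_def topis_0_iff)
  qed
qed

subsection \<open>The isomorphism\<close>

text \<open>The intertwining is assumed only on \<open>A\<close>, so the induction also carries that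
  the iterates stay in \<open>A\<close>.\<close>

lemma op_iter_commute:
  assumes "\<And>b. b \<in> A \<Longrightarrow> map_option h (f b) = g (h b)" "\<And>b c. b \<in> A \<Longrightarrow> f b = Some c \<Longrightarrow> c \<in> A" "b \<in> A"
  shows "map_option h (op_iter f m b) = op_iter g m (h b) \<and> (\<forall>c. op_iter f m b = Some c \<longrightarrow> c \<in> A)"
proof (induction m)
  case 0 then show ?case using assms(3) by (simp add: op_iter_def)
next
  case (Suc m)
  have step: "op_iter k (Suc m) x = Option.bind (op_iter k m x) k" for k :: "'z \<Rightarrow> 'z option" and x
    by (simp add: op_iter_def)
  show ?case
  proof (cases "op_iter f m b")
    case None then show ?thesis using Suc by (auto simp: step)
  next
    case (Some c)
    then have "c \<in> A" "op_iter g m (h b) = Some (h c)" using Suc by (auto dest: sym)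
    then show ?thesis using assms(1,2) Some by (auto simp: step)
  qed
qed

text \<open>Iterates on the two sides vanish simultaneously, so both \<open>GREATEST\<close> range
  over the same exponents.\<close>

lemma max_iter_commute:
  assumes "\<And>b. b \<in> A \<Longrightarrow> map_option h (f b) = g (h b)" "\<And>b c. b \<in> A \<Longrightarrow> f b = Some c \<Longrightarrow> c \<in> A" "b \<in> A"
  shows "max_iter f b = max_iter g (h b)"
proof -
  have "op_iter f m b \<noteq> None \<longleftrightarrow> op_iter g m (h b) \<noteq> None" for m
    using op_iter_commute[of A h f g b m] assms by (metis map_option_is_None)
  then show ?thesis by (simp add: max_iter_def)
qed

lemma fB_in_Bcr: "fB n i b = Some c \<Longrightarrow> c \<in> Bcr n"
  by (auto simp: fB_def inB_def split: if_splits prod.splits)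

lemma eB_in_Bcr: "eB n i b = Some c \<Longrightarrow> c \<in> Bcr n"
  by (auto simp: eB_def inB_def split: if_splits prod.splits)

lemma sf_in_L1: "sf n i C = Some D \<Longrightarrow> D \<in> L1 n"
  by (auto simp: sf_def chk_def split: if_splits prod.splits)

lemma se_in_L1: "se n i C = Some D \<Longrightarrow> D \<in> L1 n"
  by (auto simp: se_def chk_def split: if_splits prod.splits)

lemma map_Phi_content:
  assumes "1 \<le> n" "\<And>D. d = Some D \<Longrightarrow> D \<in> L1 n"
  shows "map_option (Phi n) (map_option (content n) d) = map_option (cls n) d"
  using assms Phi_content by (cases d) auto

text \<open>On the deep representative both sides reduce to \<open>f_res\<close> of its residues,
  the slice side up to \<open>content\<close>; applying \<open>Phi\<close> then turns content into
  the class.\<close>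

lemma Phi_fB:
  assumes "2 \<le> n" "i \<le> n" "b \<in> Bcr n"
  shows "map_option (Phi n) (fB n i b) = fQ n i (Phi n b)"
proof -
  obtain p q where C: "deep_rep n (Phi n b) = (p, q)" by fastforce
  have pq: "(p, q) \<in> L1 n" "per n \<le> p" "content n (p, q) = b"
    using deep_rep_Phi[OF assms(3)] assms(1) by (auto simp: C)
  then have "0 < p" by (auto simp: per_def)
  then have "fB n i b = map_option (content n) (sf n i (p, q))"
    using fB_word[OF assms(1,2) admissible_res[OF pq(1)]] sf_content_0[OF assms(1) pq(1)] sf_content_pos[OF assms(1) _ assms(2) pq(1)]
      pq(3) assms(1) by (cases "i = 0") (auto simp: content_def)
  then show ?thesis using map_Phi_content[of n "sf n i (p, q)"] sf_in_L1 assms(1) by (simp add: fQ_def C)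
qed

lemma Phi_eB:
  assumes "2 \<le> n" "i \<le> n" "b \<in> Bcr n"
  shows "map_option (Phi n) (eB n i b) = eQ n i (Phi n b)"
proof -
  obtain p q where C: "deep_rep n (Phi n b) = (p, q)" by fastforce
  have pq: "(p, q) \<in> L1 n" "per n \<le> p" "content n (p, q) = b"
    using deep_rep_Phi[OF assms(3)] assms(1) by (auto simp: C)
  then have "2 \<le> p" using assms(1) by (auto simp: per_def)
  then have "eB n i b = map_option (content n) (se n i (p, q))"
    using eB_word[OF assms(1,2) admissible_res[OF pq(1)]] se_content_0[OF assms(1) pq(1)] se_content_pos[OF assms(1) _ assms(2) pq(1)]
      pq(3) assms(1) by (cases "i = 0") (auto simp: content_def)
  then show ?thesis using map_Phi_content[of n "se n i (p, q)"] se_in_L1 assms(1) by (simp add: eQ_def C)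
qed

theorem theorem3p7:
  fixes n :: nat
  assumes "2 \<le> n"
  shows "bij_betw (Phi n) (Bcr n) (SQ n) \<and>
         (\<forall>i \<le> n. \<forall>b \<in> Bcr n.
            map_option (Phi n) (fB n i b) = fQ n i (Phi n b) \<and>
            map_option (Phi n) (eB n i b) = eQ n i (Phi n b) \<and>
            max_iter (fB n i) b = max_iter (fQ n i) (Phi n b) \<and>
            max_iter (eB n i) b = max_iter (eQ n i) (Phi n b))"
proof (intro conjI allI impI ballI)
  show "bij_betw (Phi n) (Bcr n) (SQ n)" using assms by (simp add: bij_Phi)
  fix i b assume i: "i \<le> n" and b: "b \<in> Bcr n"
  show "map_option (Phi n) (fB n i b) = fQ n i (Phi n b)" using Phi_fB[OF assms i b] .
  show "map_option (Phi n) (eB n i b) = eQ n i (Phi n b)" using Phi_eB[OF assms i b] .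
  \<comment> \<open>Agreement of these maxima for all \<open>i\<close> also gives equal weights,
    whose coefficients are their differences.\<close>
  show "max_iter (fB n i) b = max_iter (fQ n i) (Phi n b)"
    using max_iter_commute[where A = "Bcr n" and h = "Phi n"] Phi_fB[OF assms i] fB_in_Bcr b by blast
  show "max_iter (eB n i) b = max_iter (eQ n i) (Phi n b)"
    using max_iter_commute[where A = "Bcr n" and h = "Phi n"] Phi_eB[OF assms i] eB_in_Bcr b by blast
qed

end
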